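(* Let $(X,\mathcal S)$ be a $T_0$ Pervin space. Then the following are equivalent: (a) $(X,\mathcal S)$ is Cauchy complete; (b) $(X,\mathcal S)$ is complete; (c) every extremal monomorphism $(X,\mathcal S)\hookrightarrow(Y,\mathcal T)$ into a $T_0$ Pervin space $(Y,\mathcal T)$ whose symmetrization is dense is an isomorphism; (d) $(X,\mathcal S)$ is isomorphic to $\mathbf{pf}(\mathcal S)$; (e) $(X,\mathcal S)$ is isomorphic to $\mathbf{pt}(\mathrm{Idl}(\mathcal S),\mathcal S)$; (f) $(X,\mathcal S)$ is isomorphic to a Pervin space of the form $\mathbf{pt}(\mathrm{Idl}(D),D)$, for some bounded distributive lattice $D$; (g) $(X,\mathcal S)$ is isomorphic to a Pervin space of the form $\mathbf{pf}(D)$, for some bounded distributive lattice $D$.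
   Context: A Pervin space is a pair $(X,\mathcal S)$ where $X$ is a set and $\mathcal S$ is a bounded sublattice of the powerset $\mathcal P(X)$ (so $\emptyset,X\in\mathcal S$). A morphism $(X,\mathcal S)\to(Y,\mathcal T)$ is a function $f:X\to Y$ with $f^{-1}(T)\in\mathcal S$ for all $T\in\mathcal T$. $\Omega_{\mathcal S}(X)$ is the topology on $X$ generated by $\mathcal S$, and $(X,\mathcal S)$ is $T_0$ if $(X,\Omega_{\mathcal S}(X))$ is $T_0$. A morphism $f:(X,\mathcal S)\to(Y,\mathcal T)$ is dense if $f[X]$ is dense in $(Y,\Omega_{\mathcal T}(Y))$. It is an extremal monomorphism if and only if $f$ is injective and every $S\in\mathcal S$ is of the form $f^{-1}(T)$ with $T\in\mathcal T$. It is an isomorphism if and only if it is a bijection with $f[\mathcal S]=\mathcal T$. $(X,\mathcal S)$ is symmetric if $\mathcal S$ is a Boolean algebra. The symmetrization of $(X,\mathcal S)$ is $(X,\overline{\mathcal S})$ where $\overline{\mathcal S}$ is the Boolean subalgebra of $\mathcal P(X)$ generated by $\mathcal S$; the symmetrization of a morphism $f:(X,\mathcal S)\to(Y,\mathcal T)$ is the same function regarded as a morphism $(X,\overline{\mathcal S})\to(Y,\overline{\mathcal T})$. Cauchy completeness: a filter $F\subseteq\mathcal P(X)$ is a Cauchy filter of $(X,\mathcal S)$ if it is proper and for every $S\in\mathcal S$ either $S\in F$ or $X\setminus S\in F$. It converges to $x\in X$ if every $U\in\Omega_{\overline{\mathcal S}}(X)$ with $x\in U$ belongs to $F$. $(X,\mathcal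 S)$ is Cauchy complete if every Cauchy filter converges to some point. Completeness: a symmetric Pervin space $(X,\mathcal B)$ is complete if every dense extremal monomorphism $(X,\mathcal B)\hookrightarrow(Y,\mathcal C)$ with $(Y,\mathcal C)$ a $T_0$ symmetric Pervin space is an isomorphism. A general Pervin space is complete if its symmetrization is complete. For a bounded distributive lattice $D$: $\mathbf{pf}(D)=(\mathrm{pf}(D),\widetilde D)$, where $\mathrm{pf}(D)$ is the set of prime filters of $D$, $\widetilde a=\{F\in\mathrm{pf}(D)\mid a\in F\}$ and $\widetilde D=\{\widetilde a\mid a\in D\}$. $\mathrm{Idl}(D)$ is the frame of ideals of $D$, and $D$ is identified with the sublattice of principal ideals. A Frith frame is a pair $(L,S)$ with $L$ a frame and $S$ a bounded sublattice of $L$ such that every element of $L$ is a join of elements of $S$; $\mathbf{pt}(L,S)=(\mathrm{pt}(L),\widehat S)$, where $\mathrm{pt}(L)$ is the set of frame homomorphisms $p:L\to\mathbf 2$ ($\mathbf 2$ the two-element frame), $\widehat s=\{p\in\mathrm{pt}(L)\mid p(s)=1\}$ and $\widehat S=\{\widehat s\mid s\in S\}$. The Axiom of Choice (or the Prime Ideal Theorem) is not assumed. *)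

theory Defs
  imports "HOL-Analysis.Analysis" "HOL-Algebra.Complete_Lattice"
begin

section \<open>Pervin spaces\<close>

type_synonym 'a pervin = "'a set \<times> 'a set set"

abbreviation points :: "'a pervin \<Rightarrow> 'a set" where "points \<equiv> fst"
abbreviation lat :: "'a pervin \<Rightarrow> 'a set set" where "lat \<equiv> snd"

definition pervin_space :: "'a pervin \<Rightarrow> bool" where
  "pervin_space P \<longleftrightarrow> lat P \<subseteq> Pow (points P) \<and> {} \<in> lat P \<and> points P \<in> lat P \<and>
     (\<forall>S\<in>lat P. \<forall>T\<in>lat P. S \<inter> T \<in> lat P \<and> S \<union> T \<in> lat P)"

definition pervin_topology :: "'a pervin \<Rightarrow> 'a topology" where
  "pervin_topology P = topology_generated_by (lat P)"

definition T0_pervin_space :: "'a pervin \<Rightarrow> bool" where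
  "T0_pervin_space P \<longleftrightarrow> pervin_space P \<and> t0_space (pervin_topology P)"

text \<open>A map of Pervin spaces is a total HOL function of which only the values on the
  underlying set matter; preimages are therefore cut down to that set.\<close>

definition pervin_morphism :: "'a pervin \<Rightarrow> 'b pervin \<Rightarrow> ('a \<Rightarrow> 'b) \<Rightarrow> bool" where
  "pervin_morphism P Q f \<longleftrightarrow> f \<in> points P \<rightarrow> points Q \<and>
     (\<forall>T\<in>lat Q. f -` T \<inter> points P \<in> lat P)"

definition pervin_dense :: "'a pervin \<Rightarrow> 'b pervin \<Rightarrow> ('a \<Rightarrow> 'b) \<Rightarrow> bool" where
  "pervin_dense P Q f \<longleftrightarrow> pervin_morphism P Q f \<and>
     pervin_topology Q closure_of (f ` points P) = points Q"

definition pervin_extremal_mono :: "'a pervin \<Rightarrow> 'b pervin \<Rightarrow> ('a \<Rightarrow> 'b) \<Rightarrow> bool" where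
  "pervin_extremal_mono P Q f \<longleftrightarrow> pervin_morphism P Q f \<and> inj_on f (points P) \<and>
     (\<forall>S\<in>lat P. \<exists>T\<in>lat Q. S = f -` T \<inter> points P)"

definition pervin_iso :: "'a pervin \<Rightarrow> 'b pervin \<Rightarrow> ('a \<Rightarrow> 'b) \<Rightarrow> bool" where
  "pervin_iso P Q f \<longleftrightarrow> bij_betw f (points P) (points Q) \<and> (\<lambda>S. f ` S) ` lat P = lat Q"

definition pervin_isomorphic :: "'a pervin \<Rightarrow> 'b pervin \<Rightarrow> bool" where
  "pervin_isomorphic P Q \<longleftrightarrow> (\<exists>f. pervin_iso P Q f)"


section \<open>Symmetrization and completeness\<close>

definition symmetric_pervin_space :: "'a pervin \<Rightarrow> bool" where
  "symmetric_pervin_space P \<longleftrightarrow> pervin_space P \<and> algebra (points P) (lat P)"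

definition symmetrization :: "'a pervin \<Rightarrow> 'a pervin" where
  "symmetrization P = (points P, algebra (points P) hull lat P)"

text \<open>A filter on the underlying set \<open>X\<close> is a filter \<open>F\<close> on the ambient type with
  \<open>F \<le> principal X\<close>; \<open>S \<in> F\<close> reads \<open>\<forall>\<^sub>F x in F. x \<in> S\<close>.\<close>

definition cauchy_pervin_filter :: "'a pervin \<Rightarrow> 'a filter \<Rightarrow> bool" where
  "cauchy_pervin_filter P F \<longleftrightarrow> F \<le> principal (points P) \<and> F \<noteq> bot \<and>
     (\<forall>S\<in>lat P. (\<forall>\<^sub>F x in F. x \<in> S) \<or> (\<forall>\<^sub>F x in F. x \<in> points P - S))"

definition cauchy_complete_pervin :: "'a pervin \<Rightarrow> bool" where
  "cauchy_complete_pervin P \<longleftrightarrow> (\<forall>F. cauchy_pervin_filter P F \<longrightarrow>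
     (\<exists>x\<in>points P. limitin (pervin_topology (symmetrization P)) (\<lambda>y. y) x F))"

text \<open>HOL cannot quantify over types inside a formula, so notions that quantify over all
  target spaces take as a parameter the type over which the points of those targets range.
  For a source with points in \<open>'a\<close>, the type \<open>'a set set\<close> is large enough: a dense extremal
  monomorphism into a \<open>T\<^sub>0\<close> symmetric space makes each target point determine a distinct
  ultrafilter of the source Boolean algebra.\<close>

definition complete_symmetric_pervin :: "'b itself \<Rightarrow> 'a pervin \<Rightarrow> bool" where
  "complete_symmetric_pervin (_ :: 'b itself) P \<longleftrightarrow>
     (\<forall>(Q :: 'b pervin) f. T0_pervin_space Q \<and> symmetric_pervin_space Q \<and>
        pervin_extremal_mono P Q f \<and> pervin_dense P Q f \<longrightarrow> pervin_iso P Q f)"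

definition complete_pervin :: "'b itself \<Rightarrow> 'a pervin \<Rightarrow> bool" where
  "complete_pervin U P \<longleftrightarrow> complete_symmetric_pervin U (symmetrization P)"


section \<open>Bounded distributive lattices and the space of prime filters\<close>

locale bounded_distributive_lattice = bounded_lattice D for D (structure) +
  assumes distrib: "\<lbrakk>x \<in> carrier D; y \<in> carrier D; z \<in> carrier D\<rbrakk> \<Longrightarrow>
    x \<sqinter> (y \<squnion> z) = (x \<sqinter> y) \<squnion> (x \<sqinter> z)"

definition inclusion_order :: "'a set set \<Rightarrow> 'a set gorder" where
  "inclusion_order A = \<lparr>carrier = A, eq = (=), le = (\<subseteq>)\<rparr>"

definition prime_filter :: "('d, 'm) gorder_scheme \<Rightarrow> 'd set \<Rightarrow> bool" where
  "prime_filter D F \<longleftrightarrow> F \<subseteq> carrier D \<and> F \<noteq> {} \<and> F \<noteq> carrier D \<and>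
     (\<forall>a\<in>F. \<forall>b\<in>carrier D. a \<sqsubseteq>\<^bsub>D\<^esub> b \<longrightarrow> b \<in> F) \<and>
     (\<forall>a\<in>F. \<forall>b\<in>F. a \<sqinter>\<^bsub>D\<^esub> b \<in> F) \<and>
     (\<forall>a\<in>carrier D. \<forall>b\<in>carrier D. a \<squnion>\<^bsub>D\<^esub> b \<in> F \<longrightarrow> a \<in> F \<or> b \<in> F)"

definition pf :: "('d, 'm) gorder_scheme \<Rightarrow> 'd set pervin" where
  "pf D = ({F. prime_filter D F}, (\<lambda>a. {F. prime_filter D F \<and> a \<in> F}) ` carrier D)"


section \<open>Frith frames and their points\<close>

locale frame = complete_lattice L for L (structure) +
  assumes frame_distrib: "\<lbrakk>x \<in> carrier L; A \<subseteq> carrier L\<rbrakk> \<Longrightarrow>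
    x \<sqinter> (\<Squnion>A) = \<Squnion>((\<lambda>a. x \<sqinter> a) ` A)"

locale frith_frame = frame L for L (structure) and S +
  assumes sub: "S \<subseteq> carrier L"
    and bounds: "\<bottom> \<in> S" "\<top> \<in> S"
    and closed: "\<lbrakk>x \<in> S; y \<in> S\<rbrakk> \<Longrightarrow> x \<sqinter> y \<in> S" "\<lbrakk>x \<in> S; y \<in> S\<rbrakk> \<Longrightarrow> x \<squnion> y \<in> S"
    and join_dense: "x \<in> carrier L \<Longrightarrow> \<exists>A\<subseteq>S. x = \<Squnion>A"

definition two :: "bool gorder" where
  "two = \<lparr>carrier = UNIV, eq = (=), le = (\<le>)\<rparr>"

text \<open>Homomorphisms are extensional functions, so that distinct HOL functions are distinct
  homomorphisms; preservation of \<open>\<bottom>\<close> is the case \<open>A = {}\<close>.\<close>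

definition frame_hom :: "'l gorder \<Rightarrow> 'm gorder \<Rightarrow> ('l \<Rightarrow> 'm) \<Rightarrow> bool" where
  "frame_hom L M p \<longleftrightarrow> p \<in> carrier L \<rightarrow>\<^sub>E carrier M \<and> p \<top>\<^bsub>L\<^esub> = \<top>\<^bsub>M\<^esub> \<and>
     (\<forall>x\<in>carrier L. \<forall>y\<in>carrier L. p (x \<sqinter>\<^bsub>L\<^esub> y) = p x \<sqinter>\<^bsub>M\<^esub> p y) \<and>
     (\<forall>A\<subseteq>carrier L. p (\<Squnion>\<^bsub>L\<^esub>A) = \<Squnion>\<^bsub>M\<^esub>(p ` A))"

definition pt :: "'l gorder \<Rightarrow> 'l set \<Rightarrow> ('l \<Rightarrow> bool) pervin" where
  "pt L S = ({p. frame_hom L two p}, (\<lambda>s. {p. frame_hom L two p \<and> p s = \<top>\<^bsub>two\<^esub>}) ` S)"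

definition lattice_ideal :: "('d, 'm) gorder_scheme \<Rightarrow> 'd set \<Rightarrow> bool" where
  "lattice_ideal D I \<longleftrightarrow> I \<subseteq> carrier D \<and> I \<noteq> {} \<and>
     (\<forall>a\<in>I. \<forall>b\<in>carrier D. b \<sqsubseteq>\<^bsub>D\<^esub> a \<longrightarrow> b \<in> I) \<and>
     (\<forall>a\<in>I. \<forall>b\<in>I. a \<squnion>\<^bsub>D\<^esub> b \<in> I)"

definition Idl :: "('d, 'm) gorder_scheme \<Rightarrow> 'd set gorder" where
  "Idl D = inclusion_order {I. lattice_ideal D I}"

definition principal_ideals :: "('d, 'm) gorder_scheme \<Rightarrow> 'd set set" where
  "principal_ideals D = (\<lambda>a. {b \<in> carrier D. b \<sqsubseteq>\<^bsub>D\<^esub> a}) ` carrier D"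

lemma least_eq_sup:
  assumes "partial_order L" "least L s (Upper L A)"
  shows "\<Squnion>\<^bsub>L\<^esub>A = s"
proof -
  interpret partial_order L by fact
  show ?thesis
    unfolding sup_def by (rule some_equality) (use assms(2) least_unique in blast)+
qed

lemma greatest_eq_inf:
  assumes "partial_order L" "greatest L s (Lower L A)"
  shows "\<Sqinter>\<^bsub>L\<^esub>A = s"
proof -
  interpret partial_order L by fact
  show ?thesis
    unfolding inf_def by (rule some_equality) (use assms(2) greatest_unique in blast)+
qed

lemma inclusion_order_simps [simp]:
  "carrier (inclusion_order A) = A" "x \<sqsubseteq>\<^bsub>inclusion_order A\<^esub> y \<longleftrightarrow> x \<subseteq> y"
  "x .=\<^bsub>inclusion_order A\<^esub> y \<longleftrightarrow> x = y"
  by (auto simp: inclusion_order_def)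

lemma partial_order_inclusion_order: "partial_order (inclusion_order A)"
  by unfold_locales (auto simp: inclusion_order_def fun_eq_iff)

context bounded_distributive_lattice
begin

lemma ideal_bottom: "lattice_ideal D I \<Longrightarrow> \<bottom> \<in> I"
  unfolding lattice_ideal_def using bottom_closed bottom_lower by blast

lemma ideal_principal:
  assumes "a \<in> carrier D"
  shows "lattice_ideal D {b \<in> carrier D. b \<sqsubseteq> a}"
  unfolding lattice_ideal_def using assms by (auto intro: le_trans join_le)

lemma ideal_Int:
  assumes "\<And>I. I \<in> A \<Longrightarrow> lattice_ideal D I"
  shows "lattice_ideal D (carrier D \<inter> \<Inter>A)"
proof -
  have "\<bottom> \<in> carrier D \<inter> \<Inter>A" using assms ideal_bottom bottom_closed by blast
  moreover have "a \<squnion> b \<in> carrier D \<inter> \<Inter>A" if "a \<in> carrier D \<inter> \<Inter>A" "b \<in> carrier D \<inter> \<Inter>A" for a b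
    using that assms join_closed unfolding lattice_ideal_def by blast
  moreover have "b \<in> carrier D \<inter> \<Inter>A" if "a \<in> carrier D \<inter> \<Inter>A" "b \<in> carrier D" "b \<sqsubseteq> a" for a b
    using that assms unfolding lattice_ideal_def by blast
  ultimately show ?thesis unfolding lattice_ideal_def by blast
qed

lemma partial_order_Idl: "partial_order (Idl D)"
  unfolding Idl_def by (rule partial_order_inclusion_order)

lemma Idl_simps [simp]:
  "carrier (Idl D) = {I. lattice_ideal D I}" "x \<sqsubseteq>\<^bsub>Idl D\<^esub> y \<longleftrightarrow> x \<subseteq> y"
  by (auto simp: Idl_def)

lemma Idl_least:
  assumes "A \<subseteq> carrier (Idl D)"
  shows "least (Idl D) (carrier D \<inter> \<Inter>{J. lattice_ideal D J \<and> \<Union>A \<subseteq> J}) (Upper (Idl D) A)"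
proof -
  have "\<And>a. a \<in> A \<Longrightarrow> a \<subseteq> carrier D"
    using assms unfolding Idl_simps lattice_ideal_def by blast
  then show ?thesis
    using assms unfolding least_def Upper_def by (auto intro!: ideal_Int) blast
qed

lemma Idl_greatest:
  assumes "A \<subseteq> carrier (Idl D)"
  shows "greatest (Idl D) (carrier D \<inter> \<Inter>A) (Lower (Idl D) A)"
proof -
  have "\<And>I. lattice_ideal D I \<Longrightarrow> I \<subseteq> carrier D" unfolding lattice_ideal_def by blast
  then show ?thesis
    using assms by (fastforce simp: greatest_def Lower_def intro!: ideal_Int)
qed

lemmas Idl_sup = least_eq_sup[OF partial_order_Idl Idl_least]
lemmas Idl_inf = greatest_eq_inf[OF partial_order_Idl Idl_greatest]

lemma Idl_sup_le:
  assumes "A \<subseteq> carrier (Idl D)" "lattice_ideal D J" "\<And>a. a \<in> A \<Longrightarrow> a \<subseteq> J"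
  shows "\<Squnion>\<^bsub>Idl D\<^esub>A \<subseteq> J"
  unfolding Idl_sup[OF assms(1)] using assms(2,3) by blast

lemma mem_Idl_sup:
  assumes "A \<subseteq> carrier (Idl D)" "x \<in> carrier D"
    and "\<And>J. lattice_ideal D J \<Longrightarrow> \<Union>A \<subseteq> J \<Longrightarrow> x \<in> J"
  shows "x \<in> \<Squnion>\<^bsub>Idl D\<^esub>A"
  unfolding Idl_sup[OF assms(1)] using assms(2,3) by blast

lemma Idl_meet:
  assumes "lattice_ideal D I" "lattice_ideal D J"
  shows "I \<sqinter>\<^bsub>Idl D\<^esub> J = I \<inter> J"
proof -
  have "I \<subseteq> carrier D" using assms(1) unfolding lattice_ideal_def by blast
  then show ?thesis unfolding meet_def using assms by (subst Idl_inf) auto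
qed

lemma complete_lattice_Idl: "complete_lattice (Idl D)"
proof -
  interpret I: partial_order "Idl D" by (rule partial_order_Idl)
  show ?thesis
    by unfold_locales (use Idl_least Idl_greatest in blast)+
qed

lemma ideal_residual:
  assumes I: "lattice_ideal D I" and J: "lattice_ideal D J"
  shows "lattice_ideal D {x \<in> carrier D. \<forall>y\<in>I. x \<sqinter> y \<in> J}" (is "lattice_ideal D ?R")
proof -
  have IJ: "I \<subseteq> carrier D" "J \<subseteq> carrier D" using I J unfolding lattice_ideal_def by blast+
  have down: "b \<in> J" if "a \<in> J" "b \<in> carrier D" "b \<sqsubseteq> a" for a b
    using J that unfolding lattice_ideal_def by blast
  have "\<bottom> \<sqinter> y \<in> J" if "y \<in> I" for y
  proof -
    have "y \<in> carrier D" using that IJ by blast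
    then show ?thesis using down[OF ideal_bottom[OF J]] by (meson bottom_closed meet_closed meet_left)
  qed
  then have "\<bottom> \<in> ?R" using bottom_closed by blast
  moreover have "b \<in> ?R" if "a \<in> ?R" "b \<in> carrier D" "b \<sqsubseteq> a" for a b
  proof -
    have "b \<sqinter> y \<in> J" if y: "y \<in> I" for y
    proof -
      have yc: "y \<in> carrier D" using y IJ by blast
      have "b \<sqinter> y \<sqsubseteq> a \<sqinter> y"
        using yc \<open>a \<in> ?R\<close> \<open>b \<in> carrier D\<close> \<open>b \<sqsubseteq> a\<close>
        by (intro meet_le) (use le_trans[OF meet_left, of b y a] meet_right[of b y] meet_closed[of b y] in blast)+
      then show ?thesis using down[of "a \<sqinter> y" "b \<sqinter> y"] y \<open>a \<in> ?R\<close> meet_closed[OF \<open>b \<in> carrier D\<close> yc] by blast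
    qed
    then show ?thesis using that by blast
  qed
  moreover have "a \<squnion> b \<in> ?R" if "a \<in> ?R" "b \<in> ?R" for a b
  proof -
    have "(a \<squnion> b) \<sqinter> y \<in> J" if y: "y \<in> I" for y
    proof -
      have yc: "y \<in> carrier D" using y IJ by blast
      have comm: "u \<sqinter> v = v \<sqinter> u" for u v by (simp add: meet_def insert_commute)
      have "(a \<squnion> b) \<sqinter> y = (a \<sqinter> y) \<squnion> (b \<sqinter> y)"
      proof -
        have "a \<in> carrier D" "b \<in> carrier D" using \<open>a \<in> ?R\<close> \<open>b \<in> ?R\<close> by blast+
        from distrib[OF yc this] show ?thesis by (simp only: comm[of y])
      qed
      moreover have "a \<sqinter> y \<in> J" "b \<sqinter> y \<in> J" using \<open>a \<in> ?R\<close> \<open>b \<in> ?R\<close> y by blast+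
      ultimately show ?thesis using J unfolding lattice_ideal_def by simp
    qed
    moreover have "a \<squnion> b \<in> carrier D" using that join_closed by blast
    ultimately show ?thesis by blast
  qed
  ultimately show ?thesis unfolding lattice_ideal_def by blast
qed

lemma frame_Idl: "frame (Idl D)"
proof -
  interpret C: complete_lattice "Idl D" by (rule complete_lattice_Idl)
  show ?thesis
  proof unfold_locales
    fix I A assume I: "I \<in> carrier (Idl D)" and A: "A \<subseteq> carrier (Idl D)"
    have I': "lattice_ideal D I" and Ic: "I \<subseteq> carrier D"
      using I by (auto simp: lattice_ideal_def)
    have S: "lattice_ideal D (\<Squnion>\<^bsub>Idl D\<^esub>A)" using C.sup_closed[OF A] by simp
    have img: "(\<lambda>a. I \<sqinter>\<^bsub>Idl D\<^esub> a) ` A = (\<lambda>a. I \<inter> a) ` A"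
      using A I' by (intro image_cong) (auto simp: Idl_meet)
    have imgc: "(\<lambda>a. I \<inter> a) ` A \<subseteq> carrier (Idl D)"
      unfolding img[symmetric] using A C.meet_closed[OF I] by blast
    have "I \<inter> \<Squnion>\<^bsub>Idl D\<^esub>A = \<Squnion>\<^bsub>Idl D\<^esub>((\<lambda>a. I \<inter> a) ` A)"
    proof
      show "\<Squnion>\<^bsub>Idl D\<^esub>((\<lambda>a. I \<inter> a) ` A) \<subseteq> I \<inter> \<Squnion>\<^bsub>Idl D\<^esub>A"
      proof -
        have K: "lattice_ideal D (I \<inter> \<Squnion>\<^bsub>Idl D\<^esub>A)"
          using C.meet_closed[OF I C.sup_closed[OF A]] unfolding Idl_meet[OF I' S] Idl_simps by blast
        have "a \<subseteq> \<Squnion>\<^bsub>Idl D\<^esub>A" if "a \<in> A" for a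
          using C.sup_upper[OF A that] unfolding Idl_simps .
        then show ?thesis by (intro Idl_sup_le[OF imgc K]) blast
      qed
      show "I \<inter> \<Squnion>\<^bsub>Idl D\<^esub>A \<subseteq> \<Squnion>\<^bsub>Idl D\<^esub>((\<lambda>a. I \<inter> a) ` A)"
      proof
        fix x assume x: "x \<in> I \<inter> \<Squnion>\<^bsub>Idl D\<^esub>A"
        then have xc: "x \<in> carrier D" using Ic by blast
        have "x \<in> J" if J: "lattice_ideal D J" "\<Union>((\<lambda>a. I \<inter> a) ` A) \<subseteq> J" for J
        proof -
          have "a \<subseteq> {x \<in> carrier D. \<forall>y\<in>I. x \<sqinter> y \<in> J}" if a: "a \<in> A" for a
          proof
            fix z assume z: "z \<in> a"
            have ai: "lattice_ideal D a" using a A by auto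
            then have zc: "z \<in> carrier D" using z unfolding lattice_ideal_def by blast
            have "z \<sqinter> y \<in> J" if y: "y \<in> I" for y
            proof -
              have yc: "y \<in> carrier D" using y Ic by blast
              have "z \<sqinter> y \<in> carrier D" "z \<sqinter> y \<sqsubseteq> z" "z \<sqinter> y \<sqsubseteq> y"
                using meet_closed[OF zc yc] meet_left[OF zc yc] meet_right[OF zc yc] by blast+
              then have "z \<sqinter> y \<in> I \<inter> a" using ai I' y z unfolding lattice_ideal_def by blast
              then show ?thesis using J(2) a by blast
            qed
            then show "z \<in> {x \<in> carrier D. \<forall>y\<in>I. x \<sqinter> y \<in> J}" using zc by blast
          qed
          then have "\<Squnion>\<^bsub>Idl D\<^esub>A \<subseteq> {x \<in> carrier D. \<forall>y\<in>I. x \<sqinter> y \<in> J}"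
            by (rule Idl_sup_le[OF A ideal_residual[OF I' J(1)]])
          then have "x \<sqinter> x \<in> J" using x by blast
          moreover have "x \<sqsubseteq> x \<sqinter> x" by (rule meet_le[OF le_refl le_refl]) (fact xc)+
          ultimately show ?thesis using J(1) xc unfolding lattice_ideal_def by blast
        qed
        then show "x \<in> \<Squnion>\<^bsub>Idl D\<^esub>((\<lambda>a. I \<inter> a) ` A)" by (rule mem_Idl_sup[OF imgc xc])
      qed
    qed
    then show "I \<sqinter>\<^bsub>Idl D\<^esub> (\<Squnion>\<^bsub>Idl D\<^esub>A) = \<Squnion>\<^bsub>Idl D\<^esub>((\<lambda>a. I \<sqinter>\<^bsub>Idl D\<^esub> a) ` A)"
      unfolding Idl_meet[OF I' S] img .
  qed
qed

lemma principal_meet: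
  assumes a: "a \<in> carrier D" and b: "b \<in> carrier D"
  shows "{x \<in> carrier D. x \<sqsubseteq> a} \<sqinter>\<^bsub>Idl D\<^esub> {x \<in> carrier D. x \<sqsubseteq> b} =
    {x \<in> carrier D. x \<sqsubseteq> a \<sqinter> b}"
proof -
  have "x \<sqsubseteq> a \<and> x \<sqsubseteq> b \<longleftrightarrow> x \<sqsubseteq> a \<sqinter> b" if x: "x \<in> carrier D" for x
    by (meson meet_le[OF _ _ a b x] le_trans[OF _ meet_left[OF a b] x meet_closed[OF a b] a]
      le_trans[OF _ meet_right[OF a b] x meet_closed[OF a b] b])
  then show ?thesis
    unfolding Idl_meet[OF ideal_principal[OF a] ideal_principal[OF b]] by blast
qed

lemma principal_join:
  assumes a: "a \<in> carrier D" and b: "b \<in> carrier D"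
  shows "{x \<in> carrier D. x \<sqsubseteq> a} \<squnion>\<^bsub>Idl D\<^esub> {x \<in> carrier D. x \<sqsubseteq> b} =
    {x \<in> carrier D. x \<sqsubseteq> a \<squnion> b}" (is "?A \<squnion>\<^bsub>Idl D\<^esub> ?B = ?C")
  unfolding join_def[of "Idl D"]
proof (rule least_eq_sup[OF partial_order_Idl])
  have i: "lattice_ideal D ?A" "lattice_ideal D ?B" "lattice_ideal D ?C"
    by (intro ideal_principal a b join_closed)+
  have "?C \<subseteq> J" if J: "lattice_ideal D J" "?A \<subseteq> J" "?B \<subseteq> J" for J
  proof -
    have "a \<in> J" by (rule subsetD[OF J(2)]) (simp add: a)
    moreover have "b \<in> J" by (rule subsetD[OF J(3)]) (simp add: b)
    ultimately have "a \<squnion> b \<in> J" using J(1) unfolding lattice_ideal_def by simp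
    then show ?thesis using J(1) unfolding lattice_ideal_def by (metis (lifting) mem_Collect_eq subsetI)
  qed
  moreover have "?A \<subseteq> ?C"
    by (rule Collect_mono) (meson le_trans[OF _ join_left[OF a b] _ a join_closed[OF a b]])
  moreover have "?B \<subseteq> ?C"
    by (rule Collect_mono) (meson le_trans[OF _ join_right[OF a b] _ b join_closed[OF a b]])
  ultimately show "least (Idl D) ?C (Upper (Idl D) {?A, ?B})"
    using i by (simp add: least_def Upper_def)
qed

lemma ideal_eq_sup:
  assumes I: "lattice_ideal D I"
  shows "\<Squnion>\<^bsub>Idl D\<^esub>((\<lambda>a. {x \<in> carrier D. x \<sqsubseteq> a}) ` I) = I" (is "\<Squnion>\<^bsub>Idl D\<^esub>(?d ` I) = I")
proof (rule least_eq_sup[OF partial_order_Idl])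
  have Ic: "I \<subseteq> carrier D" using I by (simp add: lattice_ideal_def)
  have 1: "X \<subseteq> I" if X: "X \<in> ?d ` I" for X
  proof
    fix x assume x: "x \<in> X"
    obtain a where "a \<in> I" "X = ?d a" using X by blast
    then show "x \<in> I" using x I unfolding lattice_ideal_def by simp
  qed
  have 2: "I \<subseteq> J" if J: "\<forall>X \<in> ?d ` I. X \<subseteq> J" for J
  proof
    fix a assume a: "a \<in> I"
    have "?d a \<subseteq> J" by (rule bspec[OF J imageI[OF a]])
    moreover have "a \<in> ?d a" using subsetD[OF Ic a] by simp
    ultimately show "a \<in> J" by (rule subsetD)
  qed
  show "least (Idl D) I (Upper (Idl D) (?d ` I))"
    unfolding least_def
  proof (intro conjI ballI)
    show "Upper (Idl D) (?d ` I) \<subseteq> carrier (Idl D)" by (rule Upper_closed)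
    show "I \<in> Upper (Idl D) (?d ` I)" using 1 I by (simp add: Upper_def)
    fix J assume "J \<in> Upper (Idl D) (?d ` I)"
    moreover have "X \<in> carrier (Idl D)" if X: "X \<in> ?d ` I" for X
    proof -
      obtain a where "a \<in> I" "X = ?d a" using X by blast
      then show ?thesis using ideal_principal[OF subsetD[OF Ic]] by simp
    qed
    ultimately show "I \<sqsubseteq>\<^bsub>Idl D\<^esub> J"
      unfolding Upper_def Idl_simps(2) by (intro 2 ballI) (simp del: Idl_simps(1))
  qed
qed

lemma frith_frame_Idl: "frith_frame (Idl D) (principal_ideals D)"
proof -
  interpret F: frame "Idl D" by (rule frame_Idl)
  let ?d = "\<lambda>a. {b \<in> carrier D. b \<sqsubseteq> a}"
  have P: "?d a \<in> principal_ideals D" if "a \<in> carrier D" for a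
    using that unfolding principal_ideals_def by blast
  have E: "\<exists>a\<in>carrier D. X = ?d a" if "X \<in> principal_ideals D" for X
    using that unfolding principal_ideals_def by blast
  have d: "?d a \<in> carrier (Idl D)" if "a \<in> carrier D" for a
    using ideal_principal[OF that] by simp
  have "\<bottom>\<^bsub>Idl D\<^esub> = ?d \<bottom>"
  proof (rule F.le_antisym[OF F.bottom_lower[OF d[OF bottom_closed]] _ F.bottom_closed d[OF bottom_closed]])
    have i: "lattice_ideal D \<bottom>\<^bsub>Idl D\<^esub>" using F.bottom_closed by simp
    show "?d \<bottom> \<sqsubseteq>\<^bsub>Idl D\<^esub> \<bottom>\<^bsub>Idl D\<^esub>"
      using i ideal_bottom[OF i] unfolding lattice_ideal_def Idl_simps(2) by (metis (lifting) mem_Collect_eq subsetI)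
  qed
  from P[OF bottom_closed, folded this] have bot: "\<bottom>\<^bsub>Idl D\<^esub> \<in> principal_ideals D" .
  have "\<top>\<^bsub>Idl D\<^esub> = ?d \<top>"
  proof (rule F.le_antisym[OF _ F.top_higher[OF d[OF top_closed]] F.top_closed d[OF top_closed]])
    have "lattice_ideal D \<top>\<^bsub>Idl D\<^esub>" using F.top_closed by simp
    then have "\<top>\<^bsub>Idl D\<^esub> \<subseteq> carrier D" by (simp add: lattice_ideal_def)
    then show "\<top>\<^bsub>Idl D\<^esub> \<sqsubseteq>\<^bsub>Idl D\<^esub> ?d \<top>"
      unfolding Idl_simps(2) by (intro subsetI CollectI conjI top_higher) (erule (1) subsetD)+
  qed
  from P[OF top_closed, folded this] have top: "\<top>\<^bsub>Idl D\<^esub> \<in> principal_ideals D" .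
  show ?thesis
  proof (intro frith_frame.intro frith_frame_axioms.intro frame_Idl bot top)
    show "principal_ideals D \<subseteq> carrier (Idl D)"
      unfolding principal_ideals_def by (rule image_subsetI) (rule d)
    fix X Y assume X: "X \<in> principal_ideals D" and Y: "Y \<in> principal_ideals D"
    obtain a where a: "a \<in> carrier D" "X = ?d a" using E[OF X] by (rule bexE)
    obtain b where b: "b \<in> carrier D" "Y = ?d b" using E[OF Y] by (rule bexE)
    note ab = a(1) b(1) and XY = a(2) b(2)
    show "X \<sqinter>\<^bsub>Idl D\<^esub> Y \<in> principal_ideals D"
      unfolding XY principal_meet[OF ab] by (rule P[OF meet_closed[OF ab]])
    show "X \<squnion>\<^bsub>Idl D\<^esub> Y \<in> principal_ideals D"
      unfolding XY principal_join[OF ab] by (rule P[OF join_closed[OF ab]])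
  next
    fix I assume "I \<in> carrier (Idl D)"
    then have I: "lattice_ideal D I" by simp
    have "?d ` I \<subseteq> principal_ideals D"
      using I unfolding lattice_ideal_def principal_ideals_def by (intro image_mono) simp
    then show "\<exists>A\<subseteq>principal_ideals D. I = \<Squnion>\<^bsub>Idl D\<^esub>A" by (intro exI[of _ "?d ` I"] conjI ideal_eq_sup[OF I, symmetric])
  qed
qed

end

lemma bounded_distributive_lattice_lat:
  assumes "pervin_space P"
  shows "bounded_distributive_lattice (inclusion_order (lat P))"
proof -
  have sub: "lat P \<subseteq> Pow (points P)" and bd: "{} \<in> lat P" "points P \<in> lat P"
    and cl: "\<forall>S\<in>lat P. \<forall>T\<in>lat P. S \<inter> T \<in> lat P \<and> S \<union> T \<in> lat P"
    using assms unfolding pervin_space_def by simp_all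
  have c: "S \<inter> T \<in> lat P" "S \<union> T \<in> lat P" if "S \<in> lat P" "T \<in> lat P" for S T
    using that cl by blast+
  have l: "least (inclusion_order (lat P)) (S \<union> T) (Upper (inclusion_order (lat P)) {S, T})"
    if "S \<in> lat P" "T \<in> lat P" for S T unfolding least_def Upper_def inclusion_order_simps using that c(2)[OF that] by blast
  have g: "greatest (inclusion_order (lat P)) (S \<inter> T) (Lower (inclusion_order (lat P)) {S, T})"
    if "S \<in> lat P" "T \<in> lat P" for S T unfolding greatest_def Lower_def inclusion_order_simps using that c(1)[OF that] by blast
  have j: "S \<squnion>\<^bsub>inclusion_order (lat P)\<^esub> T = S \<union> T" if "S \<in> lat P" "T \<in> lat P" for S T
    unfolding join_def by (rule least_eq_sup[OF partial_order_inclusion_order l[OF that]])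
  have m: "S \<sqinter>\<^bsub>inclusion_order (lat P)\<^esub> T = S \<inter> T" if "S \<in> lat P" "T \<in> lat P" for S T
    unfolding meet_def by (rule greatest_eq_inf[OF partial_order_inclusion_order g[OF that]])
  have b: "least (inclusion_order (lat P)) {} (lat P)"
    "greatest (inclusion_order (lat P)) (points P) (lat P)"
    using sub bd unfolding least_def greatest_def inclusion_order_simps by blast+
  interpret partial_order "inclusion_order (lat P)" by (rule partial_order_inclusion_order)
  show ?thesis
  proof (unfold_locales, unfold inclusion_order_simps)
    show "\<exists>s. least (inclusion_order (lat P)) s (Upper (inclusion_order (lat P)) {x, y})"
      if "x \<in> lat P" "y \<in> lat P" for x y
      using l[OF that] by blast
    show "\<exists>s. greatest (inclusion_order (lat P)) s (Lower (inclusion_order (lat P)) {x, y})"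
      if "x \<in> lat P" "y \<in> lat P" for x y
      using g[OF that] by blast
    show "x \<sqinter>\<^bsub>inclusion_order (lat P)\<^esub> (y \<squnion>\<^bsub>inclusion_order (lat P)\<^esub> z) =
        (x \<sqinter>\<^bsub>inclusion_order (lat P)\<^esub> y) \<squnion>\<^bsub>inclusion_order (lat P)\<^esub> (x \<sqinter>\<^bsub>inclusion_order (lat P)\<^esub> z)"
      if "x \<in> lat P" "y \<in> lat P" "z \<in> lat P" for x y z
      using that c[of x y] c[of x z] c[of y z] j[of y z] j[of "x \<inter> y" "x \<inter> z"] m[of x "y \<union> z"] m[of x y] m[of x z]
      by (metis Int_Un_distrib)
  qed (use b in blast)+
qed

end

theory Submission
  imports Defs
begin

text \<open>
  The pivot is a reformulation of Cauchy completeness in terms of the lattice alone. A Cauchy filter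
  of \<open>(X, \<S>)\<close> decides every member of \<open>\<S>\<close>, and the members that it contains form a prime filter of
  \<open>\<S>\<close>; conversely a prime filter \<open>G\<close> generates a Cauchy filter through the differences \<open>A - B\<close> with
  \<open>A \<in> G\<close> and \<open>B \<in> \<S> - G\<close>. Such differences also form a base of the topology of the symmetrization, so
  convergence to \<open>x\<close> means that members of \<open>\<S>\<close> are decided as \<open>x\<close> decides them. Hence
  \<open>(X, \<S>)\<close> is Cauchy complete if and only if every prime filter of \<open>\<S>\<close> is of the form \<open>{S \<in> \<S>. x \<in> S}\<close>
  (lemma \<open>cauchy_complete_iff_prime_filters_fixed\<close>).

  For a \<open>T\<^sub>0\<close> space this says that the map sending \<open>x\<close> to \<open>{S \<in> \<S>. x \<in> S}\<close> is an isomorphism onto the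
  space of prime filters of \<open>\<S>\<close>. In the other direction, an isomorphism with \<open>pf D\<close> identifies \<open>\<S>\<close> with
  the basic sets of \<open>D\<close>; a prime filter of \<open>\<S>\<close> then pulls back to a prime filter of \<open>D\<close>, which is a point
  of the space (\<open>cauchy_complete_if_isomorphic_pf\<close>). The spaces \<open>pt (Idl D)\<close> lead to nothing new: a
  frame homomorphism from the ideals of \<open>D\<close> to the two-element frame is determined by the principal
  ideals it sends to the top, and these correspond to a prime filter (\<open>pervin_iso_pf_pt\<close>).

  For the extension properties, let \<open>f\<close> be an extremal monomorphism whose symmetrization is dense.
  Density makes taking preimages a lattice isomorphism, so each point of the target determines a prime
  filter of the source; if the source is Cauchy complete, then this prime filter comes from a point and
  \<open>f\<close> is onto (\<open>iso_if_cauchy_complete\<close>). Conversely, the map into the space of prime filters is always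
  such an \<open>f\<close>, so this one extension decides completeness. It has points in \<open>'a set set\<close>, for \<open>\<S>\<close> itself
  as well as for the Boolean algebra generated by \<open>\<S>\<close>. The latter handles completeness of the
  symmetrization, because a filter is Cauchy for a space exactly when it is Cauchy for its symmetrization.
\<close>

section \<open>Bases of the topologies involved\<close>

lemma openin_pervin_topology_base:
  assumes P: "pervin_space P" and U: "openin (pervin_topology P) U" and x: "x \<in> U"
  shows "\<exists>T\<in>lat P. x \<in> T \<and> T \<subseteq> U"
proof -
  have int: "S \<inter> T \<in> lat P" if "S \<in> lat P" "T \<in> lat P" for S T
    using P that unfolding pervin_space_def by blast
  have "generate_topology_on (lat P) U"
    using U unfolding pervin_topology_def openin_topology_generated_by_iff .
  then have "\<forall>x\<in>U. \<exists>T\<in>lat P. x \<in> T \<and> T \<subseteq> U"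
  proof induction
    case (Int a b)
    show ?case
    proof
      fix x assume "x \<in> a \<inter> b"
      then obtain S T where "S \<in> lat P" "x \<in> S" "S \<subseteq> a" "T \<in> lat P" "x \<in> T" "T \<subseteq> b"
        using Int.IH by blast
      then show "\<exists>T\<in>lat P. x \<in> T \<and> T \<subseteq> a \<inter> b"
        using int by (intro bexI[of _ "S \<inter> T"]) auto
    qed
  next
    case (UN K)
    then show ?case by (meson Union_iff subset_iff)
  next
    case (Basis T)
    then show ?case by (intro ballI bexI[of _ T]) simp_all
  qed simp
  then show ?thesis using x by (rule bspec)
qed

lemma topspace_pervin_topology:
  "pervin_space P \<Longrightarrow> topspace (pervin_topology P) = points P"
  unfolding pervin_topology_def topology_generated_by_topspace pervin_space_def by blast

lemma openin_pervin_topology_lat: "T \<in> lat P \<Longrightarrow> openin (pervin_topology P) T"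
  unfolding pervin_topology_def by (rule topology_generated_by_Basis)

text \<open>Every open set is a union of members of the lattice, so a separating open set can be
  shrunk to a separating member.\<close>

lemma T0_pervin_space_iff:
  "T0_pervin_space P \<longleftrightarrow> pervin_space P \<and>
     (\<forall>x\<in>points P. \<forall>y\<in>points P. (\<forall>T\<in>lat P. x \<in> T \<longleftrightarrow> y \<in> T) \<longrightarrow> x = y)"
proof (cases "pervin_space P")
  case True
  note top = topspace_pervin_topology[OF True]
  have sep: "(\<exists>U. openin (pervin_topology P) U \<and> (x \<notin> U \<longleftrightarrow> y \<in> U)) \<longleftrightarrow>
      \<not> (\<forall>T\<in>lat P. x \<in> T \<longleftrightarrow> y \<in> T)" for x y
  proof
    assume "\<exists>U. openin (pervin_topology P) U \<and> (x \<notin> U \<longleftrightarrow> y \<in> U)"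
    then obtain U where U: "openin (pervin_topology P) U" "x \<notin> U \<longleftrightarrow> y \<in> U" by blast
    show "\<not> (\<forall>T\<in>lat P. x \<in> T \<longleftrightarrow> y \<in> T)"
    proof (cases "x \<in> U")
      case True
      then show ?thesis using openin_pervin_topology_base[OF \<open>pervin_space P\<close> U(1)] U(2) by blast
    next
      case False
      then have "y \<in> U" using U(2) by blast
      then show ?thesis
        using openin_pervin_topology_base[OF \<open>pervin_space P\<close> U(1)] False by blast
    qed
  next
    assume "\<not> (\<forall>T\<in>lat P. x \<in> T \<longleftrightarrow> y \<in> T)"
    then show "\<exists>U. openin (pervin_topology P) U \<and> (x \<notin> U \<longleftrightarrow> y \<in> U)"
      using openin_pervin_topology_lat[of _ P] by blast
  qed
  have "t0_space (pervin_topology P) \<longleftrightarrow>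
      (\<forall>x\<in>points P. \<forall>y\<in>points P. (\<forall>T\<in>lat P. x \<in> T \<longleftrightarrow> y \<in> T) \<longrightarrow> x = y)"
    unfolding t0_space_def top sep by (intro ball_cong refl) argo
  then show ?thesis using True by (simp add: T0_pervin_space_def)
qed (simp add: T0_pervin_space_def)

section \<open>Symmetrization\<close>

lemma points_symmetrization [simp]: "points (symmetrization P) = points P"
  by (simp add: symmetrization_def)

lemma lat_subset_symmetrization: "T \<in> lat P \<Longrightarrow> T \<in> lat (symmetrization P)"
  by (simp add: symmetrization_def hull_inc)

lemma algebra_symmetrization:
  assumes "lat P \<subseteq> Pow (points P)"
  shows "algebra (points P) (lat (symmetrization P))"
proof -
  have pow: "algebra (points P) (Pow (points P))" by (auto simp: algebra_iff_Un)
  let ?H = "algebra (points P) hull lat P"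
  have sub: "T \<in> A" if "T \<in> ?H" "algebra (points P) A" "lat P \<subseteq> A" for T A
    using that unfolding hull_def by blast
  have "?H \<subseteq> Pow (points P)" using assms pow by (rule hull_minimal)
  moreover have "{} \<in> ?H" unfolding hull_def by (simp add: algebra_iff_Un)
  moreover have "points P - T \<in> ?H" if "T \<in> ?H" for T
    using sub[OF that] unfolding hull_def by (simp add: algebra_iff_Un)
  moreover have "S \<union> T \<in> ?H" if "S \<in> ?H" "T \<in> ?H" for S T
    using sub[OF that(1)] sub[OF that(2)] unfolding hull_def by (simp add: algebra_iff_Un)
  ultimately have "algebra (points P) ?H" unfolding algebra_iff_Un[of _ ?H] by blast
  then show ?thesis by (simp add: symmetrization_def)
qed

lemma symmetrization_induct [consumes 2, case_names base compl un]:
  assumes T: "T \<in> lat (symmetrization P)" and P: "pervin_space P"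
    and base: "\<And>T. T \<in> lat P \<Longrightarrow> R T"
    and compl: "\<And>T. T \<subseteq> points P \<Longrightarrow> R T \<Longrightarrow> R (points P - T)"
    and un: "\<And>T U. T \<subseteq> points P \<Longrightarrow> U \<subseteq> points P \<Longrightarrow> R T \<Longrightarrow> R U \<Longrightarrow> R (T \<union> U)"
  shows "R T"
proof -
  let ?A = "{T. T \<subseteq> points P \<and> R T}"
  have sub: "lat P \<subseteq> ?A" and "{} \<in> ?A" using P base unfolding pervin_space_def by blast+
  then have "algebra (points P) ?A" using compl un by (auto simp: algebra_iff_Un)
  with sub have "algebra (points P) hull lat P \<subseteq> ?A" by (rule hull_minimal)
  then show ?thesis using T by (auto simp: symmetrization_def)
qed

lemma pervin_space_of_algebra:
  assumes "algebra (points P) (lat P)" shows "pervin_space P"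
proof -
  interpret algebra "points P" "lat P" by fact
  show ?thesis unfolding pervin_space_def using space_closed by auto
qed

lemma symmetric_symmetrization:
  assumes "pervin_space P" shows "symmetric_pervin_space (symmetrization P)"
proof -
  have "algebra (points (symmetrization P)) (lat (symmetrization P))"
    using algebra_symmetrization[of P] assms unfolding pervin_space_def points_symmetrization by blast
  then show ?thesis unfolding symmetric_pervin_space_def using pervin_space_of_algebra by blast
qed

lemma pervin_space_symmetrization: "pervin_space P \<Longrightarrow> pervin_space (symmetrization P)"
  using symmetric_symmetrization unfolding symmetric_pervin_space_def by blast

lemma symmetrization_symmetric:
  "symmetric_pervin_space P \<Longrightarrow> symmetrization P = P"
  unfolding symmetric_pervin_space_def symmetrization_def by (simp add: hull_same prod_eq_iff)

lemma T0_symmetrization: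
  assumes "T0_pervin_space P" shows "T0_pervin_space (symmetrization P)"
  using assms lat_subset_symmetrization[of _ P] pervin_space_symmetrization
  unfolding T0_pervin_space_iff points_symmetrization by blast

text \<open>The sets that do not split some difference of lattice members around the point \<open>y\<close> are closed
  under complement, since the condition is symmetric in a set and its complement, and under union,
  since two differences intersect in a difference. This makes the differences a base of the topology
  of the symmetrization.\<close>

lemma symmetrization_decides:
  assumes T: "T \<in> lat (symmetrization P)" and P: "pervin_space P" and y: "y \<in> points P"
  shows "\<exists>A\<in>lat P. \<exists>B\<in>lat P. y \<in> A - B \<and> (A - B \<subseteq> T \<or> A - B \<subseteq> points P - T)"
  using T P
proof (induction rule: symmetrization_induct)
  case (base T)
  show ?case
  proof (cases "y \<in> T")
    case True
    then show ?thesis using base P unfolding pervin_space_def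
      by (intro bexI[of _ T] bexI[of _ "{}"]) auto
  next
    case False
    then show ?thesis using base P y unfolding pervin_space_def
      by (intro bexI[of _ "points P"] bexI[of _ T]) auto
  qed
next
  case (compl T)
  then show ?case by (metis double_diff subset_refl)
next
  case (un T U)
  then obtain A B A' B' where *: "A \<in> lat P" "B \<in> lat P" "y \<in> A - B"
      "A - B \<subseteq> T \<or> A - B \<subseteq> points P - T"
      "A' \<in> lat P" "B' \<in> lat P" "y \<in> A' - B'"
      "A' - B' \<subseteq> U \<or> A' - B' \<subseteq> points P - U" by blast
  then have "A \<inter> A' \<in> lat P" "B \<union> B' \<in> lat P" using P unfolding pervin_space_def by blast+
  moreover have "y \<in> A \<inter> A' - (B \<union> B')" using *(3,7) by blast
  moreover have "A \<inter> A' - (B \<union> B') \<subseteq> T \<union> U \<or> A \<inter> A' - (B \<union> B') \<subseteq> points P - (T \<union> U)"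
  proof (cases "A - B \<subseteq> T \<or> A' - B' \<subseteq> U")
    case True
    then show ?thesis by blast
  next
    case False
    then have "A - B \<subseteq> points P - T" "A' - B' \<subseteq> points P - U" using *(4,8) by blast+
    then show ?thesis by blast
  qed
  ultimately show ?case by (intro bexI conjI)
qed

lemma openin_symmetrization_base:
  assumes P: "pervin_space P" and U: "openin (pervin_topology (symmetrization P)) U" and x: "x \<in> U"
  shows "\<exists>A\<in>lat P. \<exists>B\<in>lat P. x \<in> A - B \<and> A - B \<subseteq> U"
proof -
  have P': "pervin_space (symmetrization P)" using P by (rule pervin_space_symmetrization)
  obtain T where T: "T \<in> lat (symmetrization P)" "x \<in> T" "T \<subseteq> U"
    using openin_pervin_topology_base[OF P' U x] by blast
  then have "x \<in> points P" using P' unfolding pervin_space_def by auto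
  then obtain A B where AB: "A \<in> lat P" "B \<in> lat P" "x \<in> A - B"
      "A - B \<subseteq> T \<or> A - B \<subseteq> points P - T"
    using symmetrization_decides[OF T(1) P] by metis
  then have "A - B \<subseteq> T" using T(2) by blast
  then have "A - B \<subseteq> U" using T(3) by (rule subset_trans)
  then show ?thesis using AB(1-3) by blast
qed

lemma openin_symmetrization_Diff:
  assumes P: "pervin_space P" and AB: "A \<in> lat P" "B \<in> lat P"
  shows "openin (pervin_topology (symmetrization P)) (A - B)"
proof -
  interpret algebra "points P" "lat (symmetrization P)"
    using P algebra_symmetrization unfolding pervin_space_def by blast
  show ?thesis
    by (intro openin_pervin_topology_lat Diff lat_subset_symmetrization AB)
qed

lemma pervin_morphism_symmetrization:
  assumes P: "pervin_space P" and Q: "pervin_space Q" and f: "pervin_morphism P Q f"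
  shows "pervin_morphism (symmetrization P) (symmetrization Q) f"
proof -
  interpret algebra "points P" "lat (symmetrization P)"
    using P algebra_symmetrization unfolding pervin_space_def by blast
  have fX: "f \<in> points P \<rightarrow> points Q" using f unfolding pervin_morphism_def by blast
  have "f -` T \<inter> points P \<in> lat (symmetrization P)" if "T \<in> lat (symmetrization Q)" for T
    using that Q
  proof (induction rule: symmetrization_induct)
    case (base T)
    then show ?case using f lat_subset_symmetrization unfolding pervin_morphism_def by blast
  next
    case (compl T)
    have "f -` (points Q - T) \<inter> points P = points P - (f -` T \<inter> points P)" using fX by auto
    then show ?case using compl(2) by auto
  next
    case (un T U)
    then show ?case by (auto simp: Int_Un_distrib2)
  qed
  then show ?thesis using fX unfolding pervin_morphism_def by simp
qed

text \<open>Density needs to be tested only on the base of differences of lattice members.\<close>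

lemma dense_symmetrization_iff:
  assumes P: "pervin_space P" and Q: "pervin_space Q" and f: "pervin_morphism P Q f"
  shows "pervin_dense (symmetrization P) (symmetrization Q) f \<longleftrightarrow>
    (\<forall>A\<in>lat Q. \<forall>B\<in>lat Q. A - B \<noteq> {} \<longrightarrow> (\<exists>x\<in>points P. f x \<in> A - B))" (is "_ \<longleftrightarrow> ?R")
proof -
  let ?X = "pervin_topology (symmetrization Q)"
  have top: "topspace ?X = points Q"
    using topspace_pervin_topology[OF pervin_space_symmetrization[OF Q]] by simp
  have "?X closure_of (f ` points P) = points Q \<longleftrightarrow> ?R"
  proof
    assume L: "?X closure_of (f ` points P) = points Q"
    show ?R
    proof (intro ballI impI)
      fix A B assume AB: "A \<in> lat Q" "B \<in> lat Q" "A - B \<noteq> {}"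
      then obtain y where y: "y \<in> A - B" by blast
      then have "y \<in> ?X closure_of (f ` points P)"
        unfolding L using AB(1) Q unfolding pervin_space_def by blast
      then show "\<exists>x\<in>points P. f x \<in> A - B"
        using y openin_symmetrization_Diff[OF Q AB(1,2)] unfolding in_closure_of by blast
    qed
  next
    assume R: ?R
    show "?X closure_of (f ` points P) = points Q"
    proof
      show "?X closure_of (f ` points P) \<subseteq> points Q"
        using closure_of_subset_topspace[of ?X] top by simp
      show "points Q \<subseteq> ?X closure_of (f ` points P)"
        unfolding subset_iff in_closure_of top
      proof (intro allI impI conjI)
        fix y U assume "y \<in> U \<and> openin ?X U"
        then obtain A B where AB: "A \<in> lat Q" "B \<in> lat Q" "y \<in> A - B" "A - B \<subseteq> U"
          using openin_symmetrization_base[OF Q] by metis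
        then obtain x where "x \<in> points P" "f x \<in> A - B" using R by blast
        then show "\<exists>y. y \<in> f ` points P \<and> y \<in> U" using AB(4) by blast
      qed
    qed
  qed
  then show ?thesis
    using pervin_morphism_symmetrization[OF P Q f] unfolding pervin_dense_def by simp
qed

section \<open>Prime filters\<close>

text \<open>A prime filter is the same thing as a bounded lattice homomorphism to the two-element chain.
  In this form prime filters are visibly pulled back along lattice homomorphisms.\<close>

lemma (in bounded_distributive_lattice) prime_filter_iff:
  "prime_filter D F \<longleftrightarrow> F \<subseteq> carrier D \<and> \<top> \<in> F \<and> \<bottom> \<notin> F \<and>
     (\<forall>a\<in>carrier D. \<forall>b\<in>carrier D. (a \<sqinter> b \<in> F \<longleftrightarrow> a \<in> F \<and> b \<in> F) \<and>
        (a \<squnion> b \<in> F \<longleftrightarrow> a \<in> F \<or> b \<in> F))" (is "?L \<longleftrightarrow> ?R")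
proof
  assume L: ?L
  have up: "b \<in> F" if "a \<in> F" "b \<in> carrier D" "a \<sqsubseteq> b" for a b
    using L that unfolding prime_filter_def by blast
  have sub: "F \<subseteq> carrier D" "F \<noteq> carrier D" "F \<noteq> {}" using L unfolding prime_filter_def by blast+
  then have "\<top> \<in> F" "\<bottom> \<notin> F" using up top_higher bottom_lower by blast+
  moreover have "a \<sqinter> b \<in> F \<longleftrightarrow> a \<in> F \<and> b \<in> F" if ab: "a \<in> carrier D" "b \<in> carrier D" for a b
    using up[OF _ _ meet_left[OF ab]] up[OF _ _ meet_right[OF ab]] ab L
    unfolding prime_filter_def by blast
  moreover have "a \<squnion> b \<in> F \<longleftrightarrow> a \<in> F \<or> b \<in> F" if ab: "a \<in> carrier D" "b \<in> carrier D" for a b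
    using up[OF _ _ join_left[OF ab]] up[OF _ _ join_right[OF ab]] ab join_closed L
    unfolding prime_filter_def by blast
  ultimately show ?R using sub by blast
next
  assume R: ?R
  have sub: "F \<subseteq> carrier D" using R by blast
  have "b \<in> F" if "a \<in> F" "b \<in> carrier D" "a \<sqsubseteq> b" for a b
    using R that le_iff_join[of a b] by (metis subsetD)
  moreover have "F \<noteq> {}" "F \<noteq> carrier D" using R bottom_closed by auto
  moreover have "a \<sqinter> b \<in> F" if "a \<in> F" "b \<in> F" for a b
    using R that sub by (meson subsetD)
  moreover have "a \<in> F \<or> b \<in> F" if "a \<in> carrier D" "b \<in> carrier D" "a \<squnion> b \<in> F" for a b
    using R that by metis
  ultimately show ?L unfolding prime_filter_def using sub by blast
qed

lemma inclusion_order_ops: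
  assumes P: "pervin_space P"
  shows "\<bottom>\<^bsub>inclusion_order (lat P)\<^esub> = {}" "\<top>\<^bsub>inclusion_order (lat P)\<^esub> = points P"
    and "\<lbrakk>S \<in> lat P; T \<in> lat P\<rbrakk> \<Longrightarrow> S \<sqinter>\<^bsub>inclusion_order (lat P)\<^esub> T = S \<inter> T"
    and "\<lbrakk>S \<in> lat P; T \<in> lat P\<rbrakk> \<Longrightarrow> S \<squnion>\<^bsub>inclusion_order (lat P)\<^esub> T = S \<union> T"
proof -
  interpret bounded_distributive_lattice "inclusion_order (lat P)"
    using P by (rule bounded_distributive_lattice_lat)
  note po = partial_order_inclusion_order
  show "\<bottom>\<^bsub>inclusion_order (lat P)\<^esub> = {}" "\<top>\<^bsub>inclusion_order (lat P)\<^esub> = points P"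
    using P unfolding pervin_space_def by (auto intro!: bottom_eq[symmetric] top_eq[symmetric])
  assume ST: "S \<in> lat P" "T \<in> lat P"
  then have c: "S \<inter> T \<in> lat P" "S \<union> T \<in> lat P" using P unfolding pervin_space_def by blast+
  show "S \<sqinter>\<^bsub>inclusion_order (lat P)\<^esub> T = S \<inter> T"
    unfolding meet_def by (rule greatest_eq_inf[OF po]) (use ST c in \<open>auto simp: greatest_def Lower_def\<close>)
  show "S \<squnion>\<^bsub>inclusion_order (lat P)\<^esub> T = S \<union> T"
    unfolding join_def by (rule least_eq_sup[OF po]) (use ST c in \<open>auto simp: least_def Upper_def\<close>)
qed

lemma prime_filter_lat_iff:
  assumes P: "pervin_space P"
  shows "prime_filter (inclusion_order (lat P)) G \<longleftrightarrow>
    G \<subseteq> lat P \<and> points P \<in> G \<and> {} \<notin> G \<and>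
    (\<forall>S\<in>lat P. \<forall>T\<in>lat P. (S \<inter> T \<in> G \<longleftrightarrow> S \<in> G \<and> T \<in> G) \<and> (S \<union> T \<in> G \<longleftrightarrow> S \<in> G \<or> T \<in> G))"
proof -
  interpret bounded_distributive_lattice "inclusion_order (lat P)"
    using P by (rule bounded_distributive_lattice_lat)
  show ?thesis unfolding prime_filter_iff by (auto simp: inclusion_order_ops[OF P])
qed

definition point_filter :: "'a pervin \<Rightarrow> 'a \<Rightarrow> 'a set set" where
  "point_filter P x = {T \<in> lat P. x \<in> T}"

lemma prime_point_filter:
  "pervin_space P \<Longrightarrow> x \<in> points P \<Longrightarrow> prime_filter (inclusion_order (lat P)) (point_filter P x)"
  by (subst prime_filter_lat_iff) (auto simp: point_filter_def pervin_space_def)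

section \<open>Cauchy filters and prime filters\<close>

text \<open>The members of the Boolean algebra that a filter decides form a subalgebra.\<close>

lemma cauchy_symmetrization_iff:
  assumes P: "pervin_space P"
  shows "cauchy_pervin_filter (symmetrization P) F \<longleftrightarrow> cauchy_pervin_filter P F"
proof
  assume "cauchy_pervin_filter (symmetrization P) F"
  then show "cauchy_pervin_filter P F"
    using lat_subset_symmetrization[of _ P] unfolding cauchy_pervin_filter_def by auto
next
  assume C: "cauchy_pervin_filter P F"
  have "(\<forall>\<^sub>F x in F. x \<in> S) \<or> (\<forall>\<^sub>F x in F. x \<in> points P - S)"
    if "S \<in> lat (symmetrization P)" for S
    using that P
  proof (induction rule: symmetrization_induct)
    case (base T)
    then show ?case using C unfolding cauchy_pervin_filter_def by blast
  next
    case (compl T)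
    then show ?case by (metis double_diff subset_refl)
  next
    case (un T U)
    from un(3,4) consider "\<forall>\<^sub>F x in F. x \<in> T" | "\<forall>\<^sub>F x in F. x \<in> U"
      | "\<forall>\<^sub>F x in F. x \<in> points P - T" "\<forall>\<^sub>F x in F. x \<in> points P - U" by blast
    then show ?case
    proof cases
      case 1
      then have "\<forall>\<^sub>F x in F. x \<in> T \<union> U" by eventually_elim blast
      then show ?thesis ..
    next
      case 2
      then have "\<forall>\<^sub>F x in F. x \<in> T \<union> U" by eventually_elim blast
      then show ?thesis ..
    next
      case 3
      then have "\<forall>\<^sub>F x in F. x \<in> points P - (T \<union> U)" by eventually_elim blast
      then show ?thesis ..
    qed
  qed
  then show "cauchy_pervin_filter (symmetrization P) F"
    using C unfolding cauchy_pervin_filter_def by simp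
qed

lemma cauchy_complete_symmetrization_iff:
  assumes P: "pervin_space P"
  shows "cauchy_complete_pervin (symmetrization P) \<longleftrightarrow> cauchy_complete_pervin P"
  unfolding cauchy_complete_pervin_def cauchy_symmetrization_iff[OF P] points_symmetrization
    symmetrization_symmetric[OF symmetric_symmetrization[OF P]] ..

text \<open>A Cauchy filter that does not contain a lattice member contains its complement, so the values on
  the lattice also settle the basic open sets \<open>A - B\<close> of the symmetrization.\<close>

lemma limitin_symmetrization_iff:
  assumes P: "pervin_space P" and F: "cauchy_pervin_filter P F" and x: "x \<in> points P"
  shows "limitin (pervin_topology (symmetrization P)) (\<lambda>y. y) x F \<longleftrightarrow>
    (\<forall>T\<in>lat P. (\<forall>\<^sub>F y in F. y \<in> T) \<longleftrightarrow> x \<in> T)"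
proof -
  have bd: "{} \<in> lat P" "points P \<in> lat P" using P unfolding pervin_space_def by blast+
  have nbot: "F \<noteq> bot" using F unfolding cauchy_pervin_filter_def by blast
  have dec: "(\<forall>\<^sub>F y in F. y \<in> T) \<or> (\<forall>\<^sub>F y in F. y \<in> points P - T)" if "T \<in> lat P" for T
    using F that unfolding cauchy_pervin_filter_def by blast
  have excl: False if "\<forall>\<^sub>F y in F. y \<in> T" "\<forall>\<^sub>F y in F. y \<in> points P - T" for T
  proof -
    have "\<forall>\<^sub>F y in F. False" using that by eventually_elim blast
    then show False using nbot by simp
  qed
  have top: "topspace (pervin_topology (symmetrization P)) = points P"
    using topspace_pervin_topology[OF pervin_space_symmetrization[OF P]] by simp
  show ?thesis
  proof
    assume L: "limitin (pervin_topology (symmetrization P)) (\<lambda>y. y) x F"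
    have ev: "\<forall>\<^sub>F y in F. y \<in> A - B" if "A \<in> lat P" "B \<in> lat P" "x \<in> A - B" for A B
      using L that openin_symmetrization_Diff[OF P that(1,2)] unfolding limitin_def by blast
    show "\<forall>T\<in>lat P. (\<forall>\<^sub>F y in F. y \<in> T) \<longleftrightarrow> x \<in> T"
    proof
      fix T assume T: "T \<in> lat P"
      show "(\<forall>\<^sub>F y in F. y \<in> T) \<longleftrightarrow> x \<in> T"
        using ev[OF T bd(1)] ev[OF bd(2) T] excl[of T] x by auto
    qed
  next
    assume R: "\<forall>T\<in>lat P. (\<forall>\<^sub>F y in F. y \<in> T) \<longleftrightarrow> x \<in> T"
    show "limitin (pervin_topology (symmetrization P)) (\<lambda>y. y) x F"
      unfolding limitin_def top
    proof (intro conjI x allI impI)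
      fix U assume U: "openin (pervin_topology (symmetrization P)) U \<and> x \<in> U"
      then obtain A B where AB: "A \<in> lat P" "B \<in> lat P" "x \<in> A - B" "A - B \<subseteq> U"
        using openin_symmetrization_base[OF P] by metis
      then have "\<forall>\<^sub>F y in F. y \<in> A" "\<forall>\<^sub>F y in F. y \<in> points P - B" using R dec by auto
      then show "\<forall>\<^sub>F y in F. y \<in> U" by eventually_elim (use AB in blast)
    qed
  qed
qed

text \<open>Primality is where the Cauchy condition is used: a filter that contains \<open>S \<union> T\<close> but not \<open>S\<close>
  contains the complement of \<open>S\<close>, hence \<open>T\<close>.\<close>

lemma prime_filter_of_cauchy:
  assumes P: "pervin_space P" and F: "cauchy_pervin_filter P F"
  shows "prime_filter (inclusion_order (lat P)) {T \<in> lat P. \<forall>\<^sub>F y in F. y \<in> T}"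
proof -
  have nbot: "F \<noteq> bot" and X: "\<forall>\<^sub>F y in F. y \<in> points P"
    using F unfolding cauchy_pervin_filter_def le_principal by blast+
  have dec: "(\<forall>\<^sub>F y in F. y \<in> T) \<or> (\<forall>\<^sub>F y in F. y \<in> points P - T)" if "T \<in> lat P" for T
    using F that unfolding cauchy_pervin_filter_def by blast
  have un: "(\<forall>\<^sub>F y in F. y \<in> S \<union> T) \<longleftrightarrow> (\<forall>\<^sub>F y in F. y \<in> S) \<or> (\<forall>\<^sub>F y in F. y \<in> T)"
    if S: "S \<in> lat P" for S T
  proof
    assume U: "\<forall>\<^sub>F y in F. y \<in> S \<union> T"
    show "(\<forall>\<^sub>F y in F. y \<in> S) \<or> (\<forall>\<^sub>F y in F. y \<in> T)"
    proof (rule disjCI)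
      assume "\<not> (\<forall>\<^sub>F y in F. y \<in> T)"
      show "\<forall>\<^sub>F y in F. y \<in> S"
      proof (rule ccontr)
        assume "\<not> (\<forall>\<^sub>F y in F. y \<in> S)"
        then have "\<forall>\<^sub>F y in F. y \<in> points P - S" using dec[OF S] by blast
        with U have "\<forall>\<^sub>F y in F. y \<in> T" by eventually_elim blast
        then show False using \<open>\<not> (\<forall>\<^sub>F y in F. y \<in> T)\<close> by blast
      qed
    qed
  qed (auto elim: eventually_mono)
  show ?thesis
    using P nbot X un unfolding prime_filter_lat_iff[OF P] pervin_space_def
    by (auto simp: eventually_conj_iff)
qed

text \<open>The filter generated by the differences \<open>A - B\<close> with \<open>A\<close> in and \<open>B\<close> outside a prime filter
  \<open>G\<close> is proper because \<open>A \<subseteq> B\<close> would put \<open>B\<close> into \<open>G\<close>; it decides every member of the lattice,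
  in the way \<open>G\<close> does.\<close>

lemma cauchy_of_prime_filter:
  assumes P: "pervin_space P" and G: "prime_filter (inclusion_order (lat P)) G"
  obtains F where "cauchy_pervin_filter P F" "{T \<in> lat P. \<forall>\<^sub>F y in F. y \<in> T} = G"
proof
  let ?I = "G \<times> (lat P - G)"
  let ?F = "INF (A, B)\<in>?I. principal (A - B)"
  have G': "G \<subseteq> lat P" "points P \<in> G" "{} \<notin> G"
    "\<And>S T. S \<in> lat P \<Longrightarrow> T \<in> lat P \<Longrightarrow> S \<inter> T \<in> G \<longleftrightarrow> S \<in> G \<and> T \<in> G"
    "\<And>S T. S \<in> lat P \<Longrightarrow> T \<in> lat P \<Longrightarrow> S \<union> T \<in> G \<longleftrightarrow> S \<in> G \<or> T \<in> G"
    using G unfolding prime_filter_lat_iff[OF P] by blast+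
  have P': "{} \<in> lat P" "points P \<in> lat P" "\<And>S. S \<in> lat P \<Longrightarrow> S \<subseteq> points P"
    "\<And>S T. S \<in> lat P \<Longrightarrow> T \<in> lat P \<Longrightarrow> S \<union> T \<in> lat P"
    using P unfolding pervin_space_def by blast+
  have ev: "eventually R ?F \<longleftrightarrow> (\<exists>A\<in>G. \<exists>B\<in>lat P - G. \<forall>y\<in>A - B. R y)" for R
  proof -
    have "eventually R ?F \<longleftrightarrow> (\<exists>i\<in>?I. eventually R (case i of (A, B) \<Rightarrow> principal (A - B)))"
    proof (rule eventually_INF_base)
      show "?I \<noteq> {}" using G' P' by blast
      fix i j assume i: "i \<in> ?I" and j: "j \<in> ?I"
      obtain A B A' B' where ij: "i = (A, B)" "j = (A', B')" by fastforce
      show "\<exists>k\<in>?I. (case k of (A, B) \<Rightarrow> principal (A - B)) \<le>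
          inf (case i of (A, B) \<Rightarrow> principal (A - B)) (case j of (A, B) \<Rightarrow> principal (A - B))"
      proof (rule bexI)
        show "(A \<inter> A', B \<union> B') \<in> ?I" using i j ij G'(4,5) P'(4) subsetD[OF G'(1)] by auto
      qed (auto simp: ij)
    qed
    then show ?thesis by (auto simp: eventually_principal)
  qed
  have sub: "T \<in> G" if "S \<in> G" "T \<in> lat P" "S \<subseteq> T" for S T
    using G'(5)[of S T] that G'(1) by (metis Un_absorb1 subsetD)
  have in_G: "(\<forall>\<^sub>F y in ?F. y \<in> T) \<longleftrightarrow> T \<in> G" if T: "T \<in> lat P" for T
  proof
    assume "\<forall>\<^sub>F y in ?F. y \<in> T"
    then obtain A B where AB: "A \<in> G" "B \<in> lat P - G" "A - B \<subseteq> T" unfolding ev by blast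
    then have "A \<subseteq> T \<union> B" by blast
    then have "T \<union> B \<in> G" using sub AB P'(4) T by blast
    then show "T \<in> G" using G'(5) T AB by blast
  next
    assume "T \<in> G"
    then show "\<forall>\<^sub>F y in ?F. y \<in> T" unfolding ev using G' P' by blast
  qed
  then show "{T \<in> lat P. \<forall>\<^sub>F y in ?F. y \<in> T} = G" using G'(1) by blast
  show "cauchy_pervin_filter P ?F"
    unfolding cauchy_pervin_filter_def
  proof (intro conjI ballI)
    show "?F \<le> principal (points P)" unfolding le_principal using in_G P'(2) G'(2) by blast
    have "\<not> (\<forall>\<^sub>F y in ?F. y \<in> {})" using in_G[OF P'(1)] G'(3) by blast
    then show "?F \<noteq> bot" by auto
    fix S assume S: "S \<in> lat P"
    show "(\<forall>\<^sub>F y in ?F. y \<in> S) \<or> (\<forall>\<^sub>F y in ?F. y \<in> points P - S)"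
    proof (cases "S \<in> G")
      case False
      then have "\<forall>\<^sub>F y in ?F. y \<in> points P - S" unfolding ev using S G'(2) by blast
      then show ?thesis ..
    qed (use in_G S in blast)
  qed
qed

text \<open>This is the bridge between the uniform and the lattice-theoretic conditions: a Cauchy filter
  converges to \<open>x\<close> exactly when it decides all lattice members as \<open>x\<close> does, and the ways of deciding
  them are the prime filters.\<close>

lemma cauchy_complete_iff_prime_filters_fixed:
  assumes P: "pervin_space P"
  shows "cauchy_complete_pervin P \<longleftrightarrow>
    (\<forall>G. prime_filter (inclusion_order (lat P)) G \<longrightarrow> (\<exists>x\<in>points P. G = point_filter P x))"
proof
  assume C: "cauchy_complete_pervin P"
  show "\<forall>G. prime_filter (inclusion_order (lat P)) G \<longrightarrow> (\<exists>x\<in>points P. G = point_filter P x)"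
  proof (intro allI impI)
    fix G assume "prime_filter (inclusion_order (lat P)) G"
    then obtain F where F: "cauchy_pervin_filter P F" "{T \<in> lat P. \<forall>\<^sub>F y in F. y \<in> T} = G"
      by (rule cauchy_of_prime_filter[OF P])
    then obtain x where x: "x \<in> points P" "limitin (pervin_topology (symmetrization P)) (\<lambda>y. y) x F"
      using C unfolding cauchy_complete_pervin_def by blast
    then show "\<exists>x\<in>points P. G = point_filter P x"
      using limitin_symmetrization_iff[OF P F(1) x(1)] F(2) unfolding point_filter_def by blast
  qed
next
  assume R: "\<forall>G. prime_filter (inclusion_order (lat P)) G \<longrightarrow> (\<exists>x\<in>points P. G = point_filter P x)"
  show "cauchy_complete_pervin P"
    unfolding cauchy_complete_pervin_def
  proof (intro allI impI)
    fix F assume F: "cauchy_pervin_filter P F"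
    obtain x where x: "x \<in> points P" "{T \<in> lat P. \<forall>\<^sub>F y in F. y \<in> T} = point_filter P x"
      using R prime_filter_of_cauchy[OF P F] by blast
    then show "\<exists>x\<in>points P. limitin (pervin_topology (symmetrization P)) (\<lambda>y. y) x F"
      using limitin_symmetrization_iff[OF P F x(1)] unfolding point_filter_def by blast
  qed
qed

section \<open>Spaces of prime filters\<close>

lemma points_pf: "points (pf D) = {F. prime_filter D F}"
  by (simp add: pf_def)

lemma lat_pf: "lat (pf D) = (\<lambda>a. {F. prime_filter D F \<and> a \<in> F}) ` carrier D"
  by (simp add: pf_def)

context bounded_distributive_lattice
begin

lemma pf_basic_sets:
  "{F. prime_filter D F \<and> \<bottom> \<in> F} = {}" "{F. prime_filter D F \<and> \<top> \<in> F} = points (pf D)"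
  "\<lbrakk>a \<in> carrier D; b \<in> carrier D\<rbrakk> \<Longrightarrow> {F. prime_filter D F \<and> a \<sqinter> b \<in> F} =
     {F. prime_filter D F \<and> a \<in> F} \<inter> {F. prime_filter D F \<and> b \<in> F}"
  "\<lbrakk>a \<in> carrier D; b \<in> carrier D\<rbrakk> \<Longrightarrow> {F. prime_filter D F \<and> a \<squnion> b \<in> F} =
     {F. prime_filter D F \<and> a \<in> F} \<union> {F. prime_filter D F \<and> b \<in> F}"
  by (auto simp: prime_filter_iff points_pf)

lemma T0_pf: "T0_pervin_space (pf D)"
  unfolding T0_pervin_space_iff
proof (intro conjI ballI impI)
  show "pervin_space (pf D)"
    unfolding pervin_space_def
  proof (intro conjI ballI)
    show "lat (pf D) \<subseteq> Pow (points (pf D))" unfolding lat_pf points_pf by blast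
    show "{} \<in> lat (pf D)" "points (pf D) \<in> lat (pf D)"
      unfolding lat_pf using pf_basic_sets(1,2) by blast+
    fix S T assume "S \<in> lat (pf D)" "T \<in> lat (pf D)"
    then obtain a b where ab: "a \<in> carrier D" "b \<in> carrier D"
      and ST: "S = {F. prime_filter D F \<and> a \<in> F}" "T = {F. prime_filter D F \<and> b \<in> F}"
      unfolding lat_pf by blast
    show "S \<inter> T \<in> lat (pf D)"
      unfolding lat_pf ST pf_basic_sets(3)[OF ab, symmetric]
      by (rule image_eqI[OF HOL.refl meet_closed[OF ab]])
    show "S \<union> T \<in> lat (pf D)"
      unfolding lat_pf ST pf_basic_sets(4)[OF ab, symmetric]
      by (rule image_eqI[OF HOL.refl join_closed[OF ab]])
  qed
  fix F G assume "F \<in> points (pf D)" "G \<in> points (pf D)" and *: "\<forall>T\<in>lat (pf D). F \<in> T \<longleftrightarrow> G \<in> T"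
  then have "prime_filter D F" "prime_filter D G" unfolding points_pf by auto
  then show "F = G" using * unfolding lat_pf prime_filter_iff by auto
qed

text \<open>Transport a prime filter of the lattice along the isomorphism; in a space of prime filters
  the result is itself a point, and pulling this point back recovers the given prime filter.\<close>

lemma cauchy_complete_if_isomorphic_pf:
  assumes P: "pervin_space P" and iso: "pervin_isomorphic P (pf D)"
  shows "cauchy_complete_pervin P"
  unfolding cauchy_complete_iff_prime_filters_fixed[OF P]
proof (intro allI impI)
  fix G assume G: "prime_filter (inclusion_order (lat P)) G"
  obtain f where f: "bij_betw f (points P) (points (pf D))" "(\<lambda>S. f ` S) ` lat P = lat (pf D)"
    using iso unfolding pervin_isomorphic_def pervin_iso_def by blast
  have prime_f: "prime_filter D (f x)" if "x \<in> points P" for x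
    using bij_betw_apply[OF f(1) that] unfolding points_pf by blast
  \<comment> \<open>\<open>h a\<close> is the preimage under \<open>f\<close> of the basic set of \<open>a\<close>, so \<open>h\<close> maps \<open>D\<close> onto the lattice of \<open>P\<close>.\<close>
  define h where "h a = {x \<in> points P. a \<in> f x}" for a
  have h: "h \<bottom> = {}" "h \<top> = points P"
    "\<And>a b. a \<in> carrier D \<Longrightarrow> b \<in> carrier D \<Longrightarrow> h (a \<sqinter> b) = h a \<inter> h b"
    "\<And>a b. a \<in> carrier D \<Longrightarrow> b \<in> carrier D \<Longrightarrow> h (a \<squnion> b) = h a \<union> h b"
    using prime_f unfolding h_def prime_filter_iff by auto
  have sub: "S \<subseteq> points P" if "S \<in> lat P" for S using P that unfolding pervin_space_def by blast
  have h_eq: "h a = S"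
    if "S \<in> lat P" "f ` S = {F. prime_filter D F \<and> a \<in> F}" for S a
  proof -
    have "x \<in> S \<longleftrightarrow> f x \<in> f ` S" if "x \<in> points P" for x
      using inj_on_image_mem_iff[OF bij_betw_imp_inj_on[OF f(1)] that sub] \<open>S \<in> lat P\<close> by blast
    then have "x \<in> S \<longleftrightarrow> a \<in> f x" if "x \<in> points P" for x
      unfolding \<open>f ` S = _\<close> using that prime_f by blast
    then show ?thesis using sub[OF \<open>S \<in> lat P\<close>] unfolding h_def by blast
  qed
  have h_lat: "h a \<in> lat P" if "a \<in> carrier D" for a
  proof -
    have "{F. prime_filter D F \<and> a \<in> F} \<in> (\<lambda>S. f ` S) ` lat P"
      unfolding f(2) lat_pf using that by blast
    then show ?thesis using h_eq by (metis (no_types, lifting) imageE)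
  qed
  have h_onto: "\<exists>a\<in>carrier D. h a = S" if "S \<in> lat P" for S
  proof -
    have "f ` S \<in> lat (pf D)" using f(2) that by blast
    then show ?thesis using h_eq[OF that] unfolding lat_pf by blast
  qed
  have "prime_filter D {a \<in> carrier D. h a \<in> G}"
    (is "prime_filter D ?H") unfolding prime_filter_iff
  proof (intro conjI ballI)
    note G' = G[unfolded prime_filter_lat_iff[OF P]]
    have mem: "c \<in> ?H \<longleftrightarrow> h c \<in> G" if "c \<in> carrier D" for c using that by blast
    show "\<top> \<in> ?H" "\<bottom> \<notin> ?H"
      unfolding mem[OF top_closed] mem[OF bottom_closed] h(1,2) using G' by blast+
    fix a b assume ab: "a \<in> carrier D" "b \<in> carrier D"
    note mem_ab = mem[OF ab(1)] mem[OF ab(2)] mem[OF meet_closed[OF ab]] mem[OF join_closed[OF ab]]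
    show "a \<sqinter> b \<in> ?H \<longleftrightarrow> a \<in> ?H \<and> b \<in> ?H" "a \<squnion> b \<in> ?H \<longleftrightarrow> a \<in> ?H \<or> b \<in> ?H"
      unfolding mem_ab h(3)[OF ab] h(4)[OF ab] using G' h_lat[OF ab(1)] h_lat[OF ab(2)] by metis+
  qed blast
  then have "{a \<in> carrier D. h a \<in> G} \<in> f ` points P"
    unfolding bij_betw_imp_surj_on[OF f(1)] points_pf by (rule CollectI)
  then obtain x where "{a \<in> carrier D. h a \<in> G} = f x" "x \<in> points P" by (rule imageE)
  then have x: "x \<in> points P" "f x = {a \<in> carrier D. h a \<in> G}" by simp_all
  have "S \<in> G \<longleftrightarrow> x \<in> S" if S: "S \<in> lat P" for S
  proof -
    obtain a where a: "a \<in> carrier D" "h a = S" using h_onto[OF S] by blast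
    then have "S \<in> G \<longleftrightarrow> a \<in> f x" using x(2) by blast
    then show ?thesis using x(1) a(2) unfolding h_def by blast
  qed
  moreover have "G \<subseteq> lat P" using G unfolding prime_filter_lat_iff[OF P] by blast
  ultimately show "\<exists>x\<in>points P. G = point_filter P x"
    using x(1) unfolding point_filter_def by blast
qed

end

section \<open>The embedding of a space into its space of prime filters\<close>

context
  fixes P :: "'a pervin"
  assumes T0: "T0_pervin_space P"
begin

private lemma P: "pervin_space P" using T0 unfolding T0_pervin_space_iff by blast

interpretation lat: bounded_distributive_lattice "inclusion_order (lat P)"
  using P by (rule bounded_distributive_lattice_lat)

lemma T0_pf_lat: "T0_pervin_space (pf (inclusion_order (lat P)))"
  by (rule lat.T0_pf)

lemma vimage_point_filter:
  assumes "S \<in> lat P"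
  shows "point_filter P -` {F. prime_filter (inclusion_order (lat P)) F \<and> S \<in> F} \<inter> points P = S"
  using assms P prime_point_filter[OF P] unfolding pervin_space_def by (auto simp: point_filter_def)

lemma extremal_mono_point_filter: "pervin_extremal_mono P (pf (inclusion_order (lat P))) (point_filter P)"
  unfolding pervin_extremal_mono_def pervin_morphism_def
proof (intro conjI ballI)
  show "point_filter P \<in> points P \<rightarrow> points (pf (inclusion_order (lat P)))"
    unfolding points_pf using prime_point_filter[OF P] by blast
  show "inj_on (point_filter P) (points P)"
    using T0 unfolding T0_pervin_space_iff point_filter_def by (intro inj_onI) blast
  show "point_filter P -` T \<inter> points P \<in> lat P" if "T \<in> lat (pf (inclusion_order (lat P)))" for T
    using that vimage_point_filter unfolding lat_pf by auto
  show "\<exists>T\<in>lat (pf (inclusion_order (lat P))). S = point_filter P -` T \<inter> points P" if "S \<in> lat P" for S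
  proof (rule bexI)
    show "S = point_filter P -` {F. prime_filter (inclusion_order (lat P)) F \<and> S \<in> F} \<inter> points P"
      using vimage_point_filter[OF that] by (rule sym)
    show "{F. prime_filter (inclusion_order (lat P)) F \<and> S \<in> F} \<in> lat (pf (inclusion_order (lat P)))" unfolding lat_pf using that by simp
  qed
qed

text \<open>If the difference of the basic sets of \<open>A\<close> and \<open>B\<close> is nonempty, then \<open>A\<close> is not contained in \<open>B\<close>,
  and any point of \<open>A - B\<close> is mapped into that difference.\<close>

lemma dense_point_filter:
  "pervin_dense (symmetrization P) (symmetrization (pf (inclusion_order (lat P)))) (point_filter P)"
proof -
  have Q: "pervin_space (pf (inclusion_order (lat P)))" using T0_pf_lat unfolding T0_pervin_space_iff by blast
  have m: "pervin_morphism P (pf (inclusion_order (lat P))) (point_filter P)"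
    using extremal_mono_point_filter unfolding pervin_extremal_mono_def by blast
  show ?thesis
    unfolding dense_symmetrization_iff[OF P Q m]
  proof (intro ballI impI)
    fix U V assume "U \<in> lat (pf (inclusion_order (lat P)))" "V \<in> lat (pf (inclusion_order (lat P)))" and ne: "U - V \<noteq> {}"
    then obtain A B where AB: "A \<in> lat P" "B \<in> lat P"
      "U = {F. prime_filter (inclusion_order (lat P)) F \<and> A \<in> F}" "V = {F. prime_filter (inclusion_order (lat P)) F \<and> B \<in> F}"
      unfolding lat_pf by auto
    have "\<not> A \<subseteq> B"
    proof
      assume "A \<subseteq> B"
      then have "F \<in> V" if "F \<in> U" for F
        using that AB unfolding AB prime_filter_def by auto
      then show False using ne by blast
    qed
    then obtain x where "x \<in> A - B" by blast
    then show "\<exists>x\<in>points P. point_filter P x \<in> U - V"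
      using AB P prime_point_filter[OF P] unfolding pervin_space_def point_filter_def
      by (intro bexI[of _ x]) auto
  qed
qed

lemma isomorphic_pf_if_cauchy_complete:
  assumes "cauchy_complete_pervin P"
  shows "pervin_isomorphic P (pf (inclusion_order (lat P)))"
  unfolding pervin_isomorphic_def pervin_iso_def
proof (intro exI conjI)
  have inj: "inj_on (point_filter P) (points P)"
    using extremal_mono_point_filter unfolding pervin_extremal_mono_def by blast
  have onto: "point_filter P ` points P = points (pf (inclusion_order (lat P)))"
    using assms prime_point_filter[OF P]
    unfolding cauchy_complete_iff_prime_filters_fixed[OF P] points_pf by blast
  show "bij_betw (point_filter P) (points P) (points (pf (inclusion_order (lat P))))"
    using inj onto unfolding bij_betw_def by blast
  have "point_filter P ` S = {F. prime_filter (inclusion_order (lat P)) F \<and> S \<in> F}" if "S \<in> lat P" for S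
  proof -
    have "{F. prime_filter (inclusion_order (lat P)) F \<and> S \<in> F} \<subseteq> point_filter P ` points P"
      unfolding onto points_pf by blast
    then show ?thesis
      using vimage_point_filter[OF that] by blast
  qed
  then show "(\<lambda>S. point_filter P ` S) ` lat P = lat (pf (inclusion_order (lat P)))" unfolding lat_pf by auto
qed

end

text \<open>A prime filter of a Boolean algebra contains exactly one of a member and its complement, so
  complements of basic sets are basic.\<close>

lemma symmetric_pf:
  assumes P: "symmetric_pervin_space P"
  shows "symmetric_pervin_space (pf (inclusion_order (lat P)))"
proof -
  have P': "pervin_space P" using P unfolding symmetric_pervin_space_def by blast
  interpret algebra "points P" "lat P" using P unfolding symmetric_pervin_space_def by blast
  interpret lat: bounded_distributive_lattice "inclusion_order (lat P)"
    using P' by (rule bounded_distributive_lattice_lat)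
  let ?D = "inclusion_order (lat P)"
  have Q: "pervin_space (pf ?D)" using lat.T0_pf unfolding T0_pervin_space_iff by blast
  have "points (pf ?D) - T \<in> lat (pf ?D)" if "T \<in> lat (pf ?D)" for T
  proof -
    obtain A where A: "A \<in> lat P" "T = {F. prime_filter ?D F \<and> A \<in> F}"
      using \<open>T \<in> lat (pf ?D)\<close> unfolding lat_pf by auto
    have "points P - A \<in> F \<longleftrightarrow> A \<notin> F" if F: "prime_filter ?D F" for F
    proof -
      have "A \<union> (points P - A) = points P" "A \<inter> (points P - A) = {}"
        using sets_into_space[OF A(1)] by blast+
      moreover have "(A \<inter> (points P - A) \<in> F \<longleftrightarrow> A \<in> F \<and> points P - A \<in> F) \<and>
          (A \<union> (points P - A) \<in> F \<longleftrightarrow> A \<in> F \<or> points P - A \<in> F)" "points P \<in> F" "{} \<notin> F"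
        using F A(1) compl_sets[OF A(1)] unfolding prime_filter_lat_iff[OF P'] by blast+
      ultimately show ?thesis by metis
    qed
    then have "points (pf ?D) - T = {F. prime_filter ?D F \<and> points P - A \<in> F}"
      unfolding A points_pf by blast
    then show ?thesis
      unfolding lat_pf by (rule image_eqI) (use A(1) in \<open>simp add: compl_sets\<close>)
  qed
  then have "algebra (points (pf ?D)) (lat (pf ?D))"
    using Q unfolding algebra_iff_Un pervin_space_def by simp
  then show ?thesis using Q unfolding symmetric_pervin_space_def by blast
qed

section \<open>Cauchy completeness and completeness\<close>

text \<open>Let \<open>y\<close> be a point of the target. Density in the symmetrization makes \<open>T \<mapsto> f -` T\<close> injective on
  the lattice of the target, so the preimages of the lattice members around \<open>y\<close> form a prime filter;
  the point that fixes it is mapped to \<open>y\<close> because the target is \<open>T\<^sub>0\<close>.\<close>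

lemma iso_if_cauchy_complete:
  assumes P: "pervin_space P" and C: "cauchy_complete_pervin P" and T0: "T0_pervin_space Q"
    and f: "pervin_extremal_mono P Q f"
    and dense: "pervin_dense (symmetrization P) (symmetrization Q) f"
  shows "pervin_iso P Q f"
proof -
  have Q: "pervin_space Q" using T0 unfolding T0_pervin_space_iff by blast
  have m: "pervin_morphism P Q f" and inj: "inj_on f (points P)"
    and ext: "\<And>S. S \<in> lat P \<Longrightarrow> \<exists>T\<in>lat Q. S = f -` T \<inter> points P"
    using f unfolding pervin_extremal_mono_def by blast+
  have fX: "\<And>x. x \<in> points P \<Longrightarrow> f x \<in> points Q"
    and fT: "\<And>T. T \<in> lat Q \<Longrightarrow> f -` T \<inter> points P \<in> lat P"
    using m unfolding pervin_morphism_def by blast+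
  have Q': "{} \<in> lat Q" "points Q \<in> lat Q" "\<And>T. T \<in> lat Q \<Longrightarrow> T \<subseteq> points Q"
    "\<And>S T. S \<in> lat Q \<Longrightarrow> T \<in> lat Q \<Longrightarrow> S \<inter> T \<in> lat Q"
    "\<And>S T. S \<in> lat Q \<Longrightarrow> T \<in> lat Q \<Longrightarrow> S \<union> T \<in> lat Q"
    using Q unfolding pervin_space_def by blast+
  have mono: "A \<subseteq> B"
    if AB: "A \<in> lat Q" "B \<in> lat Q" "f -` A \<inter> points P \<subseteq> f -` B \<inter> points P" for A B
  proof (rule ccontr)
    assume "\<not> A \<subseteq> B"
    then obtain x where "x \<in> points P" "f x \<in> A - B"
      using dense AB(1,2) unfolding dense_symmetrization_iff[OF P Q m] by blast
    then show False using AB(3) by blast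
  qed
  have onto: "\<exists>x\<in>points P. f x = y" if y: "y \<in> points Q" for y
  proof -
    define G where "G = {f -` T \<inter> points P |T. T \<in> lat Q \<and> y \<in> T}"
    have G: "f -` T \<inter> points P \<in> G \<longleftrightarrow> y \<in> T" if "T \<in> lat Q" for T
      unfolding G_def using that mono by blast
    have "prime_filter (inclusion_order (lat P)) G"
      unfolding prime_filter_lat_iff[OF P]
    proof (intro conjI ballI)
      show "G \<subseteq> lat P" unfolding G_def using fT by blast
      have "f -` points Q \<inter> points P = points P" using fX by blast
      then show "points P \<in> G" using G[OF Q'(2)] y by simp
      show "{} \<notin> G" using G[OF Q'(1)] by simp
      fix S S' assume "S \<in> lat P" "S' \<in> lat P"
      then obtain T T' where T: "T \<in> lat Q" "T' \<in> lat Q"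
        "S = f -` T \<inter> points P" "S' = f -` T' \<inter> points P" using ext by metis
      have eqs: "S \<inter> S' = f -` (T \<inter> T') \<inter> points P" "S \<union> S' = f -` (T \<union> T') \<inter> points P"
        unfolding T by blast+
      show "S \<inter> S' \<in> G \<longleftrightarrow> S \<in> G \<and> S' \<in> G"
        unfolding eqs(1) G[OF Q'(4)[OF T(1,2)]] unfolding T(3,4) using G T(1,2) by blast
      show "S \<union> S' \<in> G \<longleftrightarrow> S \<in> G \<or> S' \<in> G"
        unfolding eqs(2) G[OF Q'(5)[OF T(1,2)]] unfolding T(3,4) using G T(1,2) by blast
    qed
    then obtain x where x: "x \<in> points P" "G = point_filter P x"
      using C unfolding cauchy_complete_iff_prime_filters_fixed[OF P] by blast
    have "\<forall>T\<in>lat Q. f x \<in> T \<longleftrightarrow> y \<in> T"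
      using G fT x unfolding point_filter_def by blast
    then have "f x = y" using T0 fX[OF x(1)] y unfolding T0_pervin_space_iff by blast
    then show ?thesis using x(1) by blast
  qed
  have img: "f ` points P = points Q" using onto fX by blast
  have vimg: "f ` (f -` T \<inter> points P) = T" if "T \<in> lat Q" for T
  proof
    show "T \<subseteq> f ` (f -` T \<inter> points P)"
    proof
      fix y assume y: "y \<in> T"
      then have "y \<in> f ` points P" unfolding img using Q'(3)[OF that] by (rule rev_subsetD)
      then show "y \<in> f ` (f -` T \<inter> points P)" using y by blast
    qed
  qed blast
  show ?thesis
    unfolding pervin_iso_def
  proof
    show "bij_betw f (points P) (points Q)" using inj img unfolding bij_betw_def by blast
    show "(\<lambda>S. f ` S) ` lat P = lat Q"
    proof
      show "(\<lambda>S. f ` S) ` lat P \<subseteq> lat Q" using ext vimg by force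
      show "lat Q \<subseteq> (\<lambda>S. f ` S) ` lat P" using vimg fT by (metis (no_types, lifting) image_eqI subsetI)
    qed
  qed
qed

text \<open>It suffices to test completeness on the embedding into the space of prime filters: if this
  embedding is an isomorphism, then the source is a space of prime filters.\<close>

lemma cauchy_complete_iff_extremal_monos_iso:
  fixes P :: "'a pervin"
  assumes T0: "T0_pervin_space P"
  shows "cauchy_complete_pervin P \<longleftrightarrow>
    (\<forall>(Q :: 'a set set pervin) f. T0_pervin_space Q \<and> pervin_extremal_mono P Q f \<and>
       pervin_dense (symmetrization P) (symmetrization Q) f \<longrightarrow> pervin_iso P Q f)"
proof
  have P: "pervin_space P" using T0 unfolding T0_pervin_space_iff by blast
  let ?D = "inclusion_order (lat P)"
  assume "\<forall>(Q :: 'a set set pervin) f. T0_pervin_space Q \<and> pervin_extremal_mono P Q f \<and>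
    pervin_dense (symmetrization P) (symmetrization Q) f \<longrightarrow> pervin_iso P Q f"
  then have "pervin_iso P (pf ?D) (point_filter P)"
    using T0_pf_lat[OF T0] extremal_mono_point_filter[OF T0] dense_point_filter[OF T0] by metis
  then have "pervin_isomorphic P (pf ?D)" unfolding pervin_isomorphic_def by blast
  then show "cauchy_complete_pervin P"
    by (rule bounded_distributive_lattice.cauchy_complete_if_isomorphic_pf
        [OF bounded_distributive_lattice_lat[OF P] P])
next
  have P: "pervin_space P" using T0 unfolding T0_pervin_space_iff by blast
  assume "cauchy_complete_pervin P"
  then show "\<forall>(Q :: 'a set set pervin) f. T0_pervin_space Q \<and> pervin_extremal_mono P Q f \<and>
      pervin_dense (symmetrization P) (symmetrization Q) f \<longrightarrow> pervin_iso P Q f"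
    using iso_if_cauchy_complete[OF P] by blast
qed

lemma complete_if_cauchy_complete:
  fixes P :: "'a pervin"
  assumes P: "pervin_space P" and C: "cauchy_complete_pervin P"
  shows "complete_pervin TYPE('y) P"
  unfolding complete_pervin_def complete_symmetric_pervin_def
proof (intro allI impI)
  note sym = symmetrization_symmetric[OF symmetric_symmetrization[OF P]]
  fix Q :: "'y pervin" and f
  assume Q: "T0_pervin_space Q \<and> symmetric_pervin_space Q \<and>
    pervin_extremal_mono (symmetrization P) Q f \<and> pervin_dense (symmetrization P) Q f"
  show "pervin_iso (symmetrization P) Q f"
  proof (rule iso_if_cauchy_complete)
    show "cauchy_complete_pervin (symmetrization P)"
      using C cauchy_complete_symmetrization_iff[OF P] by blast
    show "pervin_dense (symmetrization (symmetrization P)) (symmetrization Q) f"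
      using Q symmetrization_symmetric[of Q] unfolding sym by metis
  qed (use Q pervin_space_symmetrization[OF P] in blast)+
qed

text \<open>Completeness only speaks about symmetric targets, so the embedding is taken into the prime filters
  of the Boolean algebra and Cauchy completeness is transferred from the symmetrization.\<close>

lemma cauchy_complete_if_complete:
  fixes P :: "'a pervin"
  assumes T0: "T0_pervin_space P" and C: "complete_pervin TYPE('a set set) P"
  shows "cauchy_complete_pervin P"
proof -
  have P: "pervin_space P" using T0 unfolding T0_pervin_space_iff by blast
  let ?B = "symmetrization P"
  let ?D = "inclusion_order (lat ?B)"
  have T0': "T0_pervin_space ?B" using T0 by (rule T0_symmetrization)
  have B: "pervin_space ?B" using T0' unfolding T0_pervin_space_iff by blast
  have sB: "symmetric_pervin_space ?B" using P by (rule symmetric_symmetrization)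
  have "pervin_dense ?B (pf ?D) (point_filter ?B)"
    using dense_point_filter[OF T0'] symmetrization_symmetric[OF sB]
      symmetrization_symmetric[OF symmetric_pf[OF sB]] by metis
  then have "pervin_isomorphic ?B (pf ?D)"
    using C T0_pf_lat[OF T0'] symmetric_pf[OF sB] extremal_mono_point_filter[OF T0']
    unfolding complete_pervin_def complete_symmetric_pervin_def pervin_isomorphic_def by blast
  then have "cauchy_complete_pervin ?B"
    by (rule bounded_distributive_lattice.cauchy_complete_if_isomorphic_pf
        [OF bounded_distributive_lattice_lat[OF B] B])
  then show ?thesis using cauchy_complete_symmetrization_iff[OF P] by blast
qed

section \<open>Points of the frame of ideals\<close>

lemma partial_order_two: "partial_order two"
  by unfold_locales (auto simp: two_def fun_eq_iff)

lemma two_ops: "\<top>\<^bsub>two\<^esub> = True" "a \<sqinter>\<^bsub>two\<^esub> b \<longleftrightarrow> a \<and> b" "\<Squnion>\<^bsub>two\<^esub>A \<longleftrightarrow> True \<in> A"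
proof -
  show "\<Squnion>\<^bsub>two\<^esub>A \<longleftrightarrow> True \<in> A"
    by (rule least_eq_sup[OF partial_order_two])
      (auto simp: least_def Upper_def two_def intro: ccontr)
  show "a \<sqinter>\<^bsub>two\<^esub> b \<longleftrightarrow> a \<and> b"
    unfolding meet_def by (rule greatest_eq_inf[OF partial_order_two])
      (auto simp: greatest_def Lower_def two_def)
  have "(SOME x. greatest two x (carrier two)) = True"
    by (rule some_equality) (auto simp: greatest_def two_def)
  then show "\<top>\<^bsub>two\<^esub> = True" unfolding top_def by simp
qed

context bounded_distributive_lattice
begin

abbreviation down :: "'a \<Rightarrow> 'a set" where
  "down a \<equiv> {b \<in> carrier D. b \<sqsubseteq> a}"

definition hom_filter :: "('a set \<Rightarrow> bool) \<Rightarrow> 'a set" where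
  "hom_filter p = {a \<in> carrier D. p (down a)}"

definition filter_hom :: "'a set \<Rightarrow> 'a set \<Rightarrow> bool" where
  "filter_hom F = (\<lambda>I\<in>carrier (Idl D). I \<inter> F \<noteq> {})"

lemma frame_hom_two_iff:
  "frame_hom (Idl D) two p \<longleftrightarrow> p \<in> extensional (carrier (Idl D)) \<and> p (carrier D) \<and>
     (\<forall>I J. lattice_ideal D I \<longrightarrow> lattice_ideal D J \<longrightarrow> (p (I \<inter> J) \<longleftrightarrow> p I \<and> p J)) \<and>
     (\<forall>A\<subseteq>carrier (Idl D). p (\<Squnion>\<^bsub>Idl D\<^esub>A) \<longleftrightarrow> (\<exists>I\<in>A. p I))"
proof -
  interpret L: frame "Idl D" by (rule frame_Idl)
  have id: "lattice_ideal D (carrier D)"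
    using ideal_principal[OF top_closed] by (metis (no_types, lifting) Collect_cong Collect_mem_eq top_higher)
  have "I \<subseteq> carrier D" if "lattice_ideal D I" for I using that unfolding lattice_ideal_def by blast
  then have top: "\<top>\<^bsub>Idl D\<^esub> = carrier D"
    using L.top_closed L.top_higher[of "carrier D"] id by (simp add: subset_antisym)
  have "p \<in> carrier (Idl D) \<rightarrow>\<^sub>E carrier two \<longleftrightarrow> p \<in> extensional (carrier (Idl D))"
    by (auto simp: PiE_def two_def)
  then show ?thesis
    unfolding frame_hom_def two_ops top using Idl_meet by (auto simp del: Idl_simps simp: Idl_simps(1)) 
qed

lemma prime_hom_filter:
  assumes "frame_hom (Idl D) two p"
  shows "prime_filter D (hom_filter p)"
proof -
  interpret L: frame "Idl D" by (rule frame_Idl)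
  have top: "p (carrier D)"
    and int: "\<And>I J. lattice_ideal D I \<Longrightarrow> lattice_ideal D J \<Longrightarrow> p (I \<inter> J) \<longleftrightarrow> p I \<and> p J"
    and sup: "\<And>A. A \<subseteq> carrier (Idl D) \<Longrightarrow> p (\<Squnion>\<^bsub>Idl D\<^esub>A) \<longleftrightarrow> (\<exists>I\<in>A. p I)"
    using assms unfolding frame_hom_two_iff by blast+
  have "\<top> \<in> hom_filter p"
  proof -
    have "down \<top> = carrier D" using top_higher by blast
    then show ?thesis using top unfolding hom_filter_def by simp
  qed
  moreover have "\<bottom> \<notin> hom_filter p"
  proof -
    have le: "\<Squnion>\<^bsub>Idl D\<^esub>{} \<subseteq> down \<bottom>"
      using Idl_sup_le[of "{}", OF _ ideal_principal[OF bottom_closed]] by simp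
    have id: "lattice_ideal D (\<Squnion>\<^bsub>Idl D\<^esub>{})" using L.sup_closed[of "{}"] by simp
    have "down \<bottom> \<subseteq> \<Squnion>\<^bsub>Idl D\<^esub>{}"
      using id ideal_bottom[OF id] unfolding lattice_ideal_def by blast
    with le have "down \<bottom> = \<Squnion>\<^bsub>Idl D\<^esub>{}" by (intro equalityI)
    then show ?thesis using sup[of "{}"] unfolding hom_filter_def by simp
  qed
  moreover have "a \<sqinter> b \<in> hom_filter p \<longleftrightarrow> a \<in> hom_filter p \<and> b \<in> hom_filter p"
    if ab: "a \<in> carrier D" "b \<in> carrier D" for a b
  proof -
    have "down (a \<sqinter> b) = down a \<inter> down b"
      using principal_meet[OF ab] unfolding Idl_meet[OF ideal_principal ideal_principal, OF ab] by simp
    then show ?thesis unfolding hom_filter_def using int ideal_principal ab by auto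
  qed
  moreover have "a \<squnion> b \<in> hom_filter p \<longleftrightarrow> a \<in> hom_filter p \<or> b \<in> hom_filter p"
    if ab: "a \<in> carrier D" "b \<in> carrier D" for a b
  proof -
    have "down (a \<squnion> b) = \<Squnion>\<^bsub>Idl D\<^esub>{down a, down b}"
      using principal_join[OF ab] unfolding join_def[of "Idl D"] by simp
    then show ?thesis
      unfolding hom_filter_def using sup[of "{down a, down b}"] ideal_principal ab by auto
  qed
  moreover have "hom_filter p \<subseteq> carrier D" unfolding hom_filter_def by blast
  ultimately show ?thesis unfolding prime_filter_iff by blast
qed

text \<open>Primality enters through joins: the complement of a prime filter is an ideal, so a join of
  ideals that avoid the filter avoids it as well.\<close>

lemma frame_hom_filter_hom:
  assumes F: "prime_filter D F"
  shows "frame_hom (Idl D) two (filter_hom F)"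
proof -
  interpret L: frame "Idl D" by (rule frame_Idl)
  have F': "F \<subseteq> carrier D" "\<top> \<in> F" "\<bottom> \<notin> F"
    "\<And>a b. a \<in> carrier D \<Longrightarrow> b \<in> carrier D \<Longrightarrow> a \<sqinter> b \<in> F \<longleftrightarrow> a \<in> F \<and> b \<in> F"
    "\<And>a b. a \<in> carrier D \<Longrightarrow> b \<in> carrier D \<Longrightarrow> a \<squnion> b \<in> F \<longleftrightarrow> a \<in> F \<or> b \<in> F"
    using F unfolding prime_filter_iff by blast+
  have val: "filter_hom F I \<longleftrightarrow> I \<inter> F \<noteq> {}" if "lattice_ideal D I" for I
    unfolding filter_hom_def using that by simp
  have compl: "lattice_ideal D (carrier D - F)"
    unfolding lattice_ideal_def
  proof (intro conjI ballI impI)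
    show "carrier D - F \<noteq> {}" using F'(3) bottom_closed by blast
    show "b \<in> carrier D - F" if "a \<in> carrier D - F" "b \<in> carrier D" "b \<sqsubseteq> a" for a b
      using F that unfolding prime_filter_def by blast
    show "a \<squnion> b \<in> carrier D - F" if "a \<in> carrier D - F" "b \<in> carrier D - F" for a b
      using F'(5)[of a b] that join_closed by blast
  qed blast
  have "down \<top> = carrier D" using top_higher by blast
  then have id: "lattice_ideal D (carrier D)" using ideal_principal[OF top_closed] by simp
  show ?thesis
    unfolding frame_hom_two_iff
  proof (intro conjI allI impI)
    show "filter_hom F \<in> extensional (carrier (Idl D))" unfolding filter_hom_def by simp
    show "filter_hom F (carrier D)" using val[OF id] F'(2) top_closed by blast
  next
    fix I J assume IJ: "lattice_ideal D I" "lattice_ideal D J"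
    then have sub: "I \<subseteq> carrier D" "J \<subseteq> carrier D" unfolding lattice_ideal_def by blast+
    have "carrier D \<inter> \<Inter>{I, J} = I \<inter> J" using sub by blast
    then have "lattice_ideal D (I \<inter> J)" using ideal_Int[of "{I, J}"] IJ by auto
    moreover have "a \<sqinter> b \<in> I \<inter> J \<inter> F" if "a \<in> I \<inter> F" "b \<in> J \<inter> F" for a b
    proof -
      have ab: "a \<in> carrier D" "b \<in> carrier D" using that sub by blast+
      have "a \<sqinter> b \<in> I"
        using IJ(1) that meet_left[OF ab] meet_closed[OF ab] unfolding lattice_ideal_def by blast
      moreover have "a \<sqinter> b \<in> J"
        using IJ(2) that meet_right[OF ab] meet_closed[OF ab] unfolding lattice_ideal_def by blast
      ultimately show ?thesis using F'(4)[OF ab] that by blast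
    qed
    ultimately show "filter_hom F (I \<inter> J) \<longleftrightarrow> filter_hom F I \<and> filter_hom F J"
      using val IJ by blast
  next
    fix A assume A: "A \<subseteq> carrier (Idl D)"
    have S: "lattice_ideal D (\<Squnion>\<^bsub>Idl D\<^esub>A)" using L.sup_closed[OF A] by simp
    have A': "lattice_ideal D I" if "I \<in> A" for I using A that by auto
    show "filter_hom F (\<Squnion>\<^bsub>Idl D\<^esub>A) \<longleftrightarrow> (\<exists>I\<in>A. filter_hom F I)"
    proof
      assume "filter_hom F (\<Squnion>\<^bsub>Idl D\<^esub>A)"
      then have "\<not> \<Squnion>\<^bsub>Idl D\<^esub>A \<subseteq> carrier D - F" using val[OF S] by blast
      then obtain I where I: "I \<in> A" "\<not> I \<subseteq> carrier D - F" using Idl_sup_le[OF A compl] by blast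
      then have "I \<inter> F \<noteq> {}" using A'[OF I(1)] unfolding lattice_ideal_def by blast
      then show "\<exists>I\<in>A. filter_hom F I" using val[OF A'[OF I(1)]] I(1) by blast
    next
      assume "\<exists>I\<in>A. filter_hom F I"
      then obtain I where I: "I \<in> A" "I \<inter> F \<noteq> {}" using val A' by blast
      then have "I \<subseteq> \<Squnion>\<^bsub>Idl D\<^esub>A" using L.sup_upper[OF A I(1)] by simp
      then show "filter_hom F (\<Squnion>\<^bsub>Idl D\<^esub>A)" using val[OF S] I(2) by blast
    qed
  qed
qed

lemma hom_filter_filter_hom:
  assumes F: "prime_filter D F"
  shows "hom_filter (filter_hom F) = F"
proof -
  have "down a \<inter> F \<noteq> {} \<longleftrightarrow> a \<in> F" if "a \<in> carrier D" for a
    using F that le_refl unfolding prime_filter_def by blast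
  then have "filter_hom F (down a) \<longleftrightarrow> a \<in> F" if "a \<in> carrier D" for a
    unfolding filter_hom_def using that ideal_principal by simp
  moreover have "F \<subseteq> carrier D" using F unfolding prime_filter_def by blast
  ultimately show ?thesis unfolding hom_filter_def by blast
qed

text \<open>An ideal is the join of the principal ideals below it, so a frame homomorphism on ideals is
  determined by its values on principal ideals.\<close>

lemma filter_hom_hom_filter:
  assumes p: "frame_hom (Idl D) two p"
  shows "filter_hom (hom_filter p) = p"
proof
  fix I
  show "filter_hom (hom_filter p) I = p I"
  proof (cases "lattice_ideal D I")
    case True
    then have "I \<subseteq> carrier D" unfolding lattice_ideal_def by blast
    moreover have "down ` I \<subseteq> carrier (Idl D)"
      using ideal_principal \<open>I \<subseteq> carrier D\<close> by auto
    then have "p (\<Squnion>\<^bsub>Idl D\<^esub>(down ` I)) \<longleftrightarrow> (\<exists>a\<in>I. p (down a))"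
      using p unfolding frame_hom_two_iff by blast
    ultimately show ?thesis
      using True unfolding ideal_eq_sup[OF True] filter_hom_def hom_filter_def by auto
  next
    case False
    then show ?thesis
      using p unfolding frame_hom_two_iff filter_hom_def extensional_def by auto
  qed
qed

lemma pervin_iso_pf_pt: "pervin_iso (pf D) (pt (Idl D) (principal_ideals D)) filter_hom"
  unfolding pervin_iso_def
proof
  show "bij_betw filter_hom (points (pf D)) (points (pt (Idl D) (principal_ideals D)))"
    by (rule bij_betw_byWitness[where f' = hom_filter])
      (auto simp: pf_def pt_def hom_filter_filter_hom filter_hom_hom_filter
        prime_hom_filter frame_hom_filter_hom)
  have "filter_hom ` {F. prime_filter D F \<and> a \<in> F} = {p. frame_hom (Idl D) two p \<and> p (down a)}"
    if a: "a \<in> carrier D" for a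
  proof -
    have "a \<in> hom_filter p \<longleftrightarrow> p (down a)" for p unfolding hom_filter_def using a by blast
    then show ?thesis
      using hom_filter_filter_hom filter_hom_hom_filter prime_hom_filter frame_hom_filter_hom
      by (auto simp: image_iff) metis+
  qed
  then show "(\<lambda>S. filter_hom ` S) ` lat (pf D) = lat (pt (Idl D) (principal_ideals D))"
    unfolding pf_def pt_def principal_ideals_def two_ops snd_conv image_image by simp
qed

end

lemma pervin_iso_comp:
  assumes "pervin_iso P Q f" "pervin_iso Q R g"
  shows "pervin_iso P R (g \<circ> f)"
proof -
  have "(\<lambda>S. (g \<circ> f) ` S) ` lat P = (\<lambda>S. g ` S) ` (\<lambda>S. f ` S) ` lat P"
    by (simp add: image_image image_comp)
  then show ?thesis using assms bij_betw_trans unfolding pervin_iso_def by metis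
qed

lemma pervin_iso_inv_into:
  assumes P: "pervin_space P" and f: "pervin_iso P Q f"
  shows "pervin_iso Q P (inv_into (points P) f)"
proof -
  have inj: "inj_on f (points P)" using f unfolding pervin_iso_def bij_betw_def by blast
  have "inv_into (points P) f ` f ` S = S" if "S \<in> lat P" for S
    using P that inj unfolding pervin_space_def by (intro inv_into_image_cancel) auto
  then have "(\<lambda>S. inv_into (points P) f ` S) ` (\<lambda>S. f ` S) ` lat P = lat P"
    by (simp add: image_image)
  then show ?thesis using f bij_betw_inv_into unfolding pervin_iso_def by metis
qed

lemma (in bounded_distributive_lattice) isomorphic_pt_iff_pf:
  "pervin_isomorphic P (pt (Idl D) (principal_ideals D)) \<longleftrightarrow> pervin_isomorphic P (pf D)"
proof -
  have "pervin_space (pf D)" using T0_pf unfolding T0_pervin_space_iff by blast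
  then show ?thesis
    using pervin_iso_comp pervin_iso_pf_pt pervin_iso_inv_into unfolding pervin_isomorphic_def by metis
qed

section \<open>The equivalence\<close>

theorem theorem4p6:
  fixes P :: "'a pervin"
  assumes "T0_pervin_space P"
  shows
    "(cauchy_complete_pervin P \<longleftrightarrow> complete_pervin TYPE('a set set) P) \<and>
     (cauchy_complete_pervin P \<longleftrightarrow>
       (\<forall>(Q :: 'a set set pervin) f. T0_pervin_space Q \<and> pervin_extremal_mono P Q f \<and>
          pervin_dense (symmetrization P) (symmetrization Q) f \<longrightarrow> pervin_iso P Q f)) \<and>
     (cauchy_complete_pervin P \<longleftrightarrow> pervin_isomorphic P (pf (inclusion_order (lat P)))) \<and>
     (cauchy_complete_pervin P \<longleftrightarrow>
       pervin_isomorphic P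
         (pt (Idl (inclusion_order (lat P))) (principal_ideals (inclusion_order (lat P))))) \<and>
     (cauchy_complete_pervin P \<longleftrightarrow>
       (\<exists>D :: 'a set gorder. bounded_distributive_lattice D \<and>
          pervin_isomorphic P (pt (Idl D) (principal_ideals D)))) \<and>
     (cauchy_complete_pervin P \<longleftrightarrow>
       (\<exists>D :: 'a set gorder. bounded_distributive_lattice D \<and> pervin_isomorphic P (pf D))) \<and>
     (cauchy_complete_pervin P \<longrightarrow>
       complete_pervin TYPE('y) P \<and>
       (\<forall>(Q :: 'y pervin) f. T0_pervin_space Q \<and> pervin_extremal_mono P Q f \<and>
          pervin_dense (symmetrization P) (symmetrization Q) f \<longrightarrow> pervin_iso P Q f)) \<and>
     ((\<exists>D :: 'd gorder. bounded_distributive_lattice D \<and>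
          (pervin_isomorphic P (pt (Idl D) (principal_ideals D)) \<or> pervin_isomorphic P (pf D)))
        \<longrightarrow> cauchy_complete_pervin P)"
proof -
  have P: "pervin_space P" using assms unfolding T0_pervin_space_iff by blast
  note D = bounded_distributive_lattice_lat[OF P]
  have pf_imp: "cauchy_complete_pervin P"
    if "bounded_distributive_lattice D" "pervin_isomorphic P (pf D)" for D :: "'e gorder"
    using bounded_distributive_lattice.cauchy_complete_if_isomorphic_pf[OF that(1) P that(2)] .
  have pt_iff: "pervin_isomorphic P (pt (Idl D) (principal_ideals D)) \<longleftrightarrow> pervin_isomorphic P (pf D)"
    if "bounded_distributive_lattice D" for D :: "'e gorder"
    using bounded_distributive_lattice.isomorphic_pt_iff_pf[OF that] .
  have imp_pf: "pervin_isomorphic P (pf (inclusion_order (lat P)))" if "cauchy_complete_pervin P"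
    using isomorphic_pf_if_cauchy_complete[OF assms that] .
  let ?D = "inclusion_order (lat P)"
  have pf: "cauchy_complete_pervin P \<longleftrightarrow> pervin_isomorphic P (pf ?D)"
    using imp_pf pf_imp[OF D] by blast
  have ex_pf: "cauchy_complete_pervin P \<longleftrightarrow>
      (\<exists>D :: 'a set gorder. bounded_distributive_lattice D \<and> pervin_isomorphic P (pf D))"
    using imp_pf pf_imp D by blast
  show ?thesis
  proof (intro conjI)
    show "cauchy_complete_pervin P \<longleftrightarrow> complete_pervin TYPE('a set set) P"
      using complete_if_cauchy_complete[OF P] cauchy_complete_if_complete[OF assms] by blast
    show "cauchy_complete_pervin P \<longleftrightarrow> pervin_isomorphic P (pt (Idl ?D) (principal_ideals ?D))"
      unfolding pt_iff[OF D] by (rule pf)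
    show "cauchy_complete_pervin P \<longleftrightarrow>
        (\<exists>D :: 'a set gorder. bounded_distributive_lattice D \<and>
          pervin_isomorphic P (pt (Idl D) (principal_ideals D)))"
      unfolding ex_pf using pt_iff by metis
    show "cauchy_complete_pervin P \<longrightarrow>
       complete_pervin TYPE('y) P \<and>
       (\<forall>(Q :: 'y pervin) f. T0_pervin_space Q \<and> pervin_extremal_mono P Q f \<and>
          pervin_dense (symmetrization P) (symmetrization Q) f \<longrightarrow> pervin_iso P Q f)"
      using complete_if_cauchy_complete[OF P] iso_if_cauchy_complete[OF P] by blast
    show "(\<exists>D :: 'd gorder. bounded_distributive_lattice D \<and>
          (pervin_isomorphic P (pt (Idl D) (principal_ideals D)) \<or> pervin_isomorphic P (pf D)))
        \<longrightarrow> cauchy_complete_pervin P"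
      using pf_imp pt_iff by metis
  qed (fact pf ex_pf cauchy_complete_iff_extremal_monos_iso[OF assms])+
qed

end
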